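(* Let $X$ be a finite point set in a Euclidean space, and let $z,z'$ be points of that Euclidean space. Let $f,g:\mathbb{R}\to\mathbb{R}^{+}$ be two non-decreasing functions, and assume that $f$ is subadditive, i.e. $f(x+y)\le f(x)+f(y)$ for all $x,y\ge 0$. Then $$d_B\big(\mathcal{B}(N(z,f)),\mathcal{B}(N(z',g))\big)\le \|f-g\|_\infty+f(\|z-z'\|),$$ where $\|f-g\|_\infty=\sup_{x\in\mathbb{R}}|f(x)-g(x)|$.
   Context: $\mathbb{R}^{+}=[0,\infty)$. For $r\in[-\infty,\infty]$ let $N_r(z)=\{x\in X\mid \|x-z\|\le r\}$, regarded as a finite metric space with the Euclidean distance (empty if $r<0$, and $X$ if $r=+\infty$). For a non-decreasing $f:\mathbb{R}\to\mathbb{R}^+$ its generalized inverse is $f^{-1}(y)=\inf\{x\in\mathbb{R}\mid f(x)\ge y\}\in[-\infty,\infty]$. Put $N_a(z,f)=N_{f^{-1}(a)}(z)$; with the inclusions for $a\le b$ this is a functor $N(z,f)$ from $(\mathbb{R},\le)$ to the category of finite metric spaces and isometric embeddings. Magnitude homology over a field $\mathbb{K}$. For a finite metric space $(Y,d)$ and $\sigma=(y_0,\dots,y_k)\in Y^{k+1}$ put $\ell(\sigma)=\sum_{i<k}d(y_i,y_{i+1})$. $\mathrm{MC}_{k,l}(Y)$ is the free $\mathbb{K}$-module on tuples $(y_0,\dots,y_k)$ with $y_i\ne y_{i+1}$ for all $i$ and $\ell=l$. The boundary is $d_{k,l}=\sum_{i=0}^k(-1)^i\partial_{i,l}$, where $\partial_{i,l}$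 omits $y_i$ if the resulting tuple still has length $l$, and is $0$ otherwise. $\mathrm{MH}_{k,l}(Y)=\ker d_{k,l}/\operatorname{im}d_{k+1,l}$. Isometric embeddings induce maps by acting on each entry of a tuple. Weighted barcode: for each weight $w\ge 0$, the functor $a\mapsto\bigoplus_k\mathrm{MH}_{k,w}(N_a(z,f))$ is a persistence module over $\mathbb{K}$; $\mathcal{B}(N(z,f))$ is the multiset of triples $([b,d],w)$ where $w\ge 0$ and $[b,d]$ runs over the bars (birth time $b$, death time $d$, possibly infinite) of the barcode of this persistence module. Bottleneck distance: $d_B(\mathcal{B}_1,\mathcal{B}_2)$ is the infimum, over all matchings between $\mathcal{B}_1$ and $\mathcal{B}_2$ that preserve weights (bars are only matched with bars of the same weight), of the supremum of the following costs: a matched pair $([b_1,d_1],w)\mapsto([b_2,d_2],w)$ costs $\max(|b_1-b_2|,|d_1-d_2|)$ (equal infinite endpoints contribute $0$); an unmatched bar $([b,d],w)$ of either barcode is paired with the diagonal point $([x,x],w)$, $x=(b+d)/2$, and costs $(d-b)/2$. *)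

theory Defs
  imports
    "HOL-Analysis.Analysis"
    "HOL-Library.Poly_Mapping"
    "HOL-Algebra.AbelCoset"
    "HOL-Algebra.Module"
begin

section \<open>Vector spaces with explicit carriers\<close>

text \<open>
  The ground field is a type of class \<open>field\<close>. Vector spaces over it are records of the
  HOL-Algebra type \<open>('k, 'v) module\<close>. The ring multiplication and the unit that this record type
  carries along play no role and are left undefined.
\<close>

definition quotient_module :: "('k, 'v) module \<Rightarrow> 'v set \<Rightarrow> ('k, 'v set) module" where
  "quotient_module M N =
     \<lparr>carrier = a_rcosets\<^bsub>M\<^esub> N, mult = undefined, one = undefined,
      zero = N, add = set_add M,
      smult = (\<lambda>c C. \<Union>x\<in>C. N +>\<^bsub>M\<^esub> (c \<odot>\<^bsub>M\<^esub> x))\<rparr>"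

definition module_dsum :: "'i set \<Rightarrow> ('i \<Rightarrow> ('k, 'v) module) \<Rightarrow> ('k, 'i \<Rightarrow> 'v) module" where
  "module_dsum I M =
     \<lparr>carrier = {x \<in> (\<Pi>\<^sub>E i\<in>I. carrier (M i)). finite {i \<in> I. x i \<noteq> \<zero>\<^bsub>M i\<^esub>}},
      mult = undefined, one = undefined,
      zero = (\<lambda>i\<in>I. \<zero>\<^bsub>M i\<^esub>),
      add = (\<lambda>x y. \<lambda>i\<in>I. x i \<oplus>\<^bsub>M i\<^esub> y i),
      smult = (\<lambda>c x. \<lambda>i\<in>I. c \<odot>\<^bsub>M i\<^esub> x i)\<rparr>"

definition linear_iso :: "('k, 'v) module \<Rightarrow> ('k, 'w) module \<Rightarrow> ('v \<Rightarrow> 'w) \<Rightarrow> bool" where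
  "linear_iso M N h \<longleftrightarrow>
     bij_betw h (carrier M) (carrier N) \<and>
     (\<forall>x\<in>carrier M. \<forall>y\<in>carrier M. h (x \<oplus>\<^bsub>M\<^esub> y) = h x \<oplus>\<^bsub>N\<^esub> h y) \<and>
     (\<forall>c. \<forall>x\<in>carrier M. h (c \<odot>\<^bsub>M\<^esub> x) = c \<odot>\<^bsub>N\<^esub> h x)"

section \<open>Magnitude homology\<close>

text \<open>
  A finite metric space is a finite subset of a type of class \<open>metric_space\<close>, with the
  restricted distance. A tuple \<open>(y\<^sub>0, \<dots>, y\<^sub>k)\<close> is a list of length \<open>k + 1\<close>.
\<close>

definition path_length :: "'a::metric_space list \<Rightarrow> real" where
  "path_length \<sigma> = (\<Sum>i<length \<sigma> - 1. dist (\<sigma> ! i) (\<sigma> ! Suc i))"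

definition mag_tuples :: "nat \<Rightarrow> real \<Rightarrow> 'a::metric_space set \<Rightarrow> 'a list set" where
  "mag_tuples k l Y =
     {\<sigma>. length \<sigma> = Suc k \<and> set \<sigma> \<subseteq> Y \<and> (\<forall>i<k. \<sigma> ! i \<noteq> \<sigma> ! Suc i) \<and> path_length \<sigma> = l}"

definition scale_chain :: "'k::field \<Rightarrow> ('s \<Rightarrow>\<^sub>0 'k) \<Rightarrow> ('s \<Rightarrow>\<^sub>0 'k)" where
  "scale_chain c p = Poly_Mapping.map ((*) c) p"

definition linear_extension :: "('s \<Rightarrow> ('t \<Rightarrow>\<^sub>0 'k)) \<Rightarrow> ('s \<Rightarrow>\<^sub>0 'k) \<Rightarrow> ('t \<Rightarrow>\<^sub>0 'k::field)" where
  "linear_extension g p = (\<Sum>\<sigma>\<in>Poly_Mapping.keys p. scale_chain (Poly_Mapping.lookup p \<sigma>) (g \<sigma>))"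

definition MC :: "nat \<Rightarrow> real \<Rightarrow> 'a::metric_space set \<Rightarrow> ('k::field, 'a list \<Rightarrow>\<^sub>0 'k) module" where
  "MC k l Y =
     \<lparr>carrier = {p. Poly_Mapping.keys p \<subseteq> mag_tuples k l Y}, mult = undefined, one = undefined,
      zero = 0, add = (+), smult = scale_chain\<rparr>"

definition omit :: "nat \<Rightarrow> 'a list \<Rightarrow> 'a list" where
  "omit i \<sigma> = take i \<sigma> @ drop (Suc i) \<sigma>"

text \<open>
  The first condition makes the boundary vanish in degree \<open>0\<close>: the complex is not augmented,
  although the empty list would have the same length as a one-element list.
\<close>

definition face :: "nat \<Rightarrow> 'a::metric_space list \<Rightarrow> ('a list \<Rightarrow>\<^sub>0 'k::field)" where
  "face i \<sigma> =
     (if length \<sigma> \<ge> 2 \<and> path_length (omit i \<sigma>) = path_length \<sigma>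
      then Poly_Mapping.single (omit i \<sigma>) 1 else 0)"

definition boundary :: "('a::metric_space list \<Rightarrow>\<^sub>0 'k) \<Rightarrow> ('a list \<Rightarrow>\<^sub>0 'k::field)" where
  "boundary = linear_extension (\<lambda>\<sigma>. \<Sum>i<length \<sigma>. scale_chain ((- 1) ^ i) (face i \<sigma>))"

definition mag_cycles ::
    "nat \<Rightarrow> real \<Rightarrow> 'a::metric_space set \<Rightarrow> ('k::field, 'a list \<Rightarrow>\<^sub>0 'k) module" where
  "mag_cycles k l Y = (MC k l Y)\<lparr>carrier := {p \<in> carrier (MC k l Y). boundary p = 0}\<rparr>"

definition mag_boundaries ::
    "nat \<Rightarrow> real \<Rightarrow> 'a::metric_space set \<Rightarrow> ('a list \<Rightarrow>\<^sub>0 'k::field) set" where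
  "mag_boundaries k l Y = boundary ` carrier (MC (Suc k) l Y)"

definition MH ::
    "nat \<Rightarrow> real \<Rightarrow> 'a::metric_space set \<Rightarrow> ('k::field, ('a list \<Rightarrow>\<^sub>0 'k) set) module" where
  "MH k l Y = quotient_module (mag_cycles k l Y) (mag_boundaries k l Y)"

definition pushforward :: "('a \<Rightarrow> 'b) \<Rightarrow> ('a list \<Rightarrow>\<^sub>0 'k) \<Rightarrow> ('b list \<Rightarrow>\<^sub>0 'k::field)" where
  "pushforward \<phi> = linear_extension (\<lambda>\<sigma>. Poly_Mapping.single (List.map \<phi> \<sigma>) 1)"

text \<open>The map induced on homology by an isometric embedding \<open>\<phi>\<close> into \<open>Y'\<close>.\<close>

definition MH_map ::
    "nat \<Rightarrow> real \<Rightarrow> 'b::metric_space set \<Rightarrow> ('a::metric_space \<Rightarrow> 'b) \<Rightarrow>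
     ('a list \<Rightarrow>\<^sub>0 'k::field) set \<Rightarrow> ('b list \<Rightarrow>\<^sub>0 'k) set" where
  "MH_map k l Y' \<phi> C =
     (\<Union>p\<in>C. mag_boundaries k l Y' +>\<^bsub>mag_cycles k l Y'\<^esub> pushforward \<phi> p)"

section \<open>Persistence modules and their barcodes\<close>

text \<open>
  \<open>pmod_map P a b\<close> is the structure map from parameter \<open>a\<close> to parameter \<open>b\<close>; it is relevant only
  for \<open>a \<le> b\<close>, and only on the carrier of \<open>pmod_space P a\<close>.
\<close>

record ('k, 'v) pmod =
  pmod_space :: "real \<Rightarrow> ('k, 'v) module"
  pmod_map :: "real \<Rightarrow> real \<Rightarrow> 'v \<Rightarrow> 'v"

definition pmod_dsum :: "'i set \<Rightarrow> ('i \<Rightarrow> ('k, 'v) pmod) \<Rightarrow> ('k, 'i \<Rightarrow> 'v) pmod" where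
  "pmod_dsum I P =
     \<lparr>pmod_space = (\<lambda>a. module_dsum I (\<lambda>i. pmod_space (P i) a)),
      pmod_map = (\<lambda>a b x. \<lambda>i\<in>I. pmod_map (P i) a b (x i))\<rparr>"

definition pmod_isomorphic :: "('k, 'v) pmod \<Rightarrow> ('k, 'w) pmod \<Rightarrow> bool" where
  "pmod_isomorphic P Q \<longleftrightarrow>
     (\<exists>h. (\<forall>a. linear_iso (pmod_space P a) (pmod_space Q a) (h a)) \<and>
          (\<forall>a b. a \<le> b \<longrightarrow>
             (\<forall>x\<in>carrier (pmod_space P a). h b (pmod_map P a b x) = pmod_map Q a b (h a x))))"

definition interval_pmod :: "real set \<Rightarrow> ('k::field, 'k) pmod" where
  "interval_pmod J =
     \<lparr>pmod_space = (\<lambda>a. \<lparr>carrier = (if a \<in> J then UNIV else {0}), mult = undefined,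
                         one = undefined, zero = 0, add = (+), smult = (*)\<rparr>),
      pmod_map = (\<lambda>a b x. if a \<in> J \<and> b \<in> J then x else 0)\<rparr>"

definition interval_decomposition :: "('k::field, 'v) pmod \<Rightarrow> real set multiset \<Rightarrow> bool" where
  "interval_decomposition P B \<longleftrightarrow>
     (\<forall>J\<in>#B. is_interval J \<and> J \<noteq> {}) \<and>
     pmod_isomorphic P (pmod_dsum {(J, i). i < count B J} (\<lambda>(J, i). interval_pmod J))"

text \<open>
  The decomposition is unique by the Krull-Schmidt-Azumaya theorem. The bars of a barcode may be
  open, closed or half-open; only birth and death times are kept afterwards.
\<close>

definition barcode :: "('k::field, 'v) pmod \<Rightarrow> real set multiset" where
  "barcode P = (SOME B. interval_decomposition P B)"

definition birth_death :: "real set \<Rightarrow> ereal \<times> ereal" where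
  "birth_death J = (Inf (ereal ` J), Sup (ereal ` J))"

definition MH_pmod ::
    "nat \<Rightarrow> real \<Rightarrow> (real \<Rightarrow> 'a::metric_space set) \<Rightarrow> ('k::field, ('a list \<Rightarrow>\<^sub>0 'k) set) pmod" where
  "MH_pmod k w N =
     \<lparr>pmod_space = (\<lambda>a. MH k w (N a)), pmod_map = (\<lambda>a b. MH_map k w (N b) id)\<rparr>"

definition MH_pmod_total ::
    "real \<Rightarrow> (real \<Rightarrow> 'a::metric_space set) \<Rightarrow> ('k::field, nat \<Rightarrow> ('a list \<Rightarrow>\<^sub>0 'k) set) pmod" where
  "MH_pmod_total w N = pmod_dsum UNIV (\<lambda>k. MH_pmod k w N)"

text \<open>
  A weighted bar is a triple \<open>((b, d), w)\<close>. A multiset of weighted bars is given by its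
  multiplicity function, because it has infinitely many elements in general.
\<close>

type_synonym wbar = "(ereal \<times> ereal) \<times> real"

definition weighted_barcode ::
    "'k::field itself \<Rightarrow> (real \<Rightarrow> 'a::metric_space set) \<Rightarrow> wbar \<Rightarrow> nat" where
  "weighted_barcode _ N = (\<lambda>(bd, w).
     if w \<ge> 0
     then count (image_mset birth_death
                  (barcode (MH_pmod_total w N :: ('k, nat \<Rightarrow> ('a list \<Rightarrow>\<^sub>0 'k) set) pmod))) bd
     else 0)"

section \<open>Bottleneck distance\<close>

text \<open>The elements of a multiset with repetitions made distinguishable by a second component.\<close>

definition instances :: "('t \<Rightarrow> nat) \<Rightarrow> ('t \<times> nat) set" where
  "instances m = {(t, i). i < m t}"

definition weight_matching ::
    "(wbar \<Rightarrow> nat) \<Rightarrow> (wbar \<Rightarrow> nat) \<Rightarrow> ((wbar \<times> nat) \<times> (wbar \<times> nat)) set \<Rightarrow> bool" where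
  "weight_matching B1 B2 M \<longleftrightarrow>
     M \<subseteq> instances B1 \<times> instances B2 \<and> single_valued M \<and> single_valued (M\<inverse>) \<and>
     (\<forall>(s, t)\<in>M. snd (fst s) = snd (fst t))"

text \<open>On \<open>ereal\<close>, the difference \<open>\<infinity> - \<infinity>\<close> is \<open>\<infinity>\<close>, whence the case distinction.\<close>

definition endpoint_dist :: "ereal \<Rightarrow> ereal \<Rightarrow> ereal" where
  "endpoint_dist x y = (if x = y then 0 else \<bar>x - y\<bar>)"

fun matched_cost :: "wbar \<Rightarrow> wbar \<Rightarrow> ereal" where
  "matched_cost ((b1, d1), _) ((b2, d2), _) = max (endpoint_dist b1 b2) (endpoint_dist d1 d2)"

fun unmatched_cost :: "wbar \<Rightarrow> ereal" where
  "unmatched_cost ((b, d), _) = (d - b) / 2"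

text \<open>The element \<open>0\<close> makes the supremum of an empty set of costs \<open>0\<close> rather than \<open>-\<infinity>\<close>.\<close>

definition matching_cost ::
    "(wbar \<Rightarrow> nat) \<Rightarrow> (wbar \<Rightarrow> nat) \<Rightarrow> ((wbar \<times> nat) \<times> (wbar \<times> nat)) set \<Rightarrow> ereal" where
  "matching_cost B1 B2 M = Sup ({0}
     \<union> {matched_cost (fst s) (fst t) | s t. (s, t) \<in> M}
     \<union> {unmatched_cost (fst s) | s. s \<in> instances B1 - Domain M}
     \<union> {unmatched_cost (fst t) | t. t \<in> instances B2 - Range M})"

definition bottleneck_dist :: "(wbar \<Rightarrow> nat) \<Rightarrow> (wbar \<Rightarrow> nat) \<Rightarrow> ereal" where
  "bottleneck_dist B1 B2 = Inf {matching_cost B1 B2 M | M. weight_matching B1 B2 M}"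

section \<open>The filtration of a point set around a point\<close>

definition nbhd :: "'a::real_normed_vector set \<Rightarrow> ereal \<Rightarrow> 'a \<Rightarrow> 'a set" where
  "nbhd X r z = {x \<in> X. ereal (norm (x - z)) \<le> r}"

definition gen_inverse :: "(real \<Rightarrow> real) \<Rightarrow> real \<Rightarrow> ereal" where
  "gen_inverse f y = Inf (ereal ` {x. f x \<ge> y})"

definition nbhd_filtration ::
    "'a::real_normed_vector set \<Rightarrow> 'a \<Rightarrow> (real \<Rightarrow> real) \<Rightarrow> real \<Rightarrow> 'a set" where
  "nbhd_filtration X z f a = nbhd X (gen_inverse f a) z"

definition sup_dist :: "(real \<Rightarrow> real) \<Rightarrow> (real \<Rightarrow> real) \<Rightarrow> ereal" where
  "sup_dist f g = (SUP x. ereal \<bar>f x - g x\<bar>)"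

end

theory Submission
  imports Defs
begin

text \<open>
  In a Euclidean space the magnitude homology of a finite set \<open>A\<close> is explicit: its basis consists of
  the thin tuples, those in which no entry lies strictly between its two neighbours and no point of
  \<open>A\<close> lies strictly between two consecutive entries. A thin tuple is a cycle, no boundary involves
  it, and on the other tuples inserting or removing a suitable point of \<open>A\<close> in the first
  available place is a contracting homotopy. Hence the persistence module of any filtration \<open>N\<close> of
  a finite set is a direct sum of intervals indexed by tuples \<open>\<sigma>\<close> that do not depend on \<open>N\<close>: the bar of
  \<open>\<sigma>\<close> begins when all entries of \<open>\<sigma>\<close> are present, and ends when a point appears in a gap. The barcode
  is this family of intervals, since the ranks of the structure maps determine a finite multiset of
  intervals.

  With \<open>\<delta> = \<parallel>f - g\<parallel>\<^sub>\<infinity> + f \<parallel>z - z'\<parallel>\<close>, subadditivity of \<open>f\<close> gives \<open>N\<^sub>a(z, f) \<subseteq> N\<^bsub>a+\<delta>\<^esub>(z', g)\<close> and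
  conversely, so matching the two bars of each tuple \<open>\<sigma>\<close> moves both endpoints by at most \<open>\<delta>\<close>, and a bar
  whose tuple has no bar in the other filtration has length at most \<open>2\<delta>\<close>.
\<close>

section \<open>Betweenness in Euclidean spaces\<close>

definition btw :: "'a::metric_space \<Rightarrow> 'a \<Rightarrow> 'a \<Rightarrow> bool" where
  "btw a b c \<longleftrightarrow> b \<noteq> a \<and> b \<noteq> c \<and> dist a c = dist a b + dist b c"

lemma btw_commute: "btw a b c \<longleftrightarrow> btw c b a"
  by (auto simp: btw_def dist_commute)

lemma btw_irrefl [simp]: "\<not> btw a a c" "\<not> btw a c c" "\<not> btw a c a"
  by (auto simp: btw_def dist_commute [of c a])

text \<open>The route from \<open>a\<close> to \<open>d\<close> through \<open>b\<close> and
  \<open>c\<close> is as long as \<open>dist a d\<close>, so both triangle inequalities in the proof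
  are equalities. This works in every metric space.\<close>

lemma btw_trans_inner:
  assumes "btw a b d" "btw b c d"
  shows "btw a b c" "btw a c d"
proof -
  have "dist a d \<le> dist a c + dist c d" "dist a c \<le> dist a b + dist b c"
    by (simp_all add: dist_triangle)
  moreover have "dist b c > 0" "dist a b > 0"
    using assms by (auto simp: btw_def)
  ultimately show "btw a b c" "btw a c d"
    using assms by (auto simp: btw_def dist_commute)
qed

text \<open>Equality in the triangle inequality makes the outer steps \<open>u\<close> and
  \<open>w\<close> nonnegative multiples of the nonzero middle step \<open>v\<close>, so all lengths
  add up. Euclidean geometry enters here: among the vertices of a 4-cycle the conclusion
  fails.\<close>

lemma btw_trans_outer:
  fixes a b c d :: "'a::euclidean_space"
  assumes "btw a b c" "btw b c d"
  shows "btw a b d" "btw a c d"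
proof -
  define u v w where "u = b - a" and "v = c - b" and "w = d - c"
  have nz: "norm v > 0" "norm u > 0"
    using assms by (auto simp: btw_def u_def v_def)
  have norms: "dist a b = norm u" "dist b c = norm v" "dist c d = norm w"
    "dist a c = norm (u + v)" "dist b d = norm (v + w)" "dist a d = norm (u + (v + w))"
    by (auto simp: u_def v_def w_def dist_norm norm_minus_commute)
  have "norm (u + v) = norm u + norm v" "norm (v + w) = norm v + norm w"
    using assms norms by (auto simp: btw_def)
  hence "norm u *\<^sub>R v = norm v *\<^sub>R u" "norm v *\<^sub>R w = norm w *\<^sub>R v"
    by (auto simp: norm_triangle_eq)
  hence "(norm u / norm v) *\<^sub>R v = u" "(norm w / norm v) *\<^sub>R v = w"
    using nz by (simp_all add: vector_fraction_eq_iff)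
  then obtain p q where pq: "p \<ge> 0" "q \<ge> 0" "u = p *\<^sub>R v" "w = q *\<^sub>R v"
    by (metis divide_nonneg_nonneg norm_ge_zero)
  have "norm (u + (v + w)) = norm ((p + (1 + q)) *\<^sub>R v)"
    by (simp add: pq scaleR_add_left)
  also have "\<dots> = (p + (1 + q)) * norm v"
    using pq(1,2) by simp
  also have "\<dots> = norm u + (norm v + norm w)"
    using pq by (simp add: algebra_simps)
  finally have "dist a d = dist a b + dist b c + dist c d"
    by (simp add: norms)
  moreover have "dist a b > 0" "dist b c > 0" "dist c d > 0"
    using assms by (auto simp: btw_def)
  ultimately show "btw a b d" "btw a c d"
    using assms by (auto simp: btw_def dist_commute [of d c] dist_commute [of b a])
qed

text \<open>Both points lie on the segment from \<open>x\<close> to \<open>y\<close>, where their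
  parameters are ordered. This makes the point picked by \<open>nearest\<close> unique.\<close>

lemma btw_linear:
  fixes x y :: "'a::euclidean_space"
  assumes "btw x p y" "btw x q y"
  shows "p = q \<or> btw x p q \<or> btw x q p"
proof -
  have *: "\<exists>t>0. p = x + t *\<^sub>R (y - x)" if "btw x p y" for p
  proof -
    have "p \<in> closed_segment x y"
      using that unfolding btw_def between_mem_segment [symmetric] between by simp
    then obtain t where t: "0 \<le> t" "p = (1 - t) *\<^sub>R x + t *\<^sub>R y"
      unfolding closed_segment_def by blast
    have "t \<noteq> 0"
      using t(2) that by (auto simp: btw_def)
    thus ?thesis
      using t by (intro exI [of _ t]) (auto simp: algebra_simps)
  qed
  have mono: "btw x p q"
    if "0 < s" "s < t" "p = x + s *\<^sub>R (y - x)" "q = x + t *\<^sub>R (y - x)" for s t p q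
  proof -
    have "q - p = (t - s) *\<^sub>R (y - x)" "p - x = s *\<^sub>R (y - x)" "q - x = t *\<^sub>R (y - x)"
      unfolding that(3,4) by (simp_all add: algebra_simps)
    moreover have "dist p q = norm (q - p)" "dist x p = norm (p - x)" "dist x q = norm (q - x)"
      by (simp_all add: dist_norm norm_minus_commute)
    ultimately have "dist p q = (t - s) * norm (y - x)" "dist x p = s * norm (y - x)"
      "dist x q = t * norm (y - x)"
      using that by simp_all
    moreover have "norm (y - x) > 0"
      using assms by auto
    moreover from calculation have "dist x p > 0" "dist p q > 0"
      using that(1,2) by (simp_all del: zero_less_dist_iff)
    ultimately show ?thesis
      by (auto simp: btw_def algebra_simps)
  qed
  obtain s t where "s > 0" "p = x + s *\<^sub>R (y - x)" "t > 0" "q = x + t *\<^sub>R (y - x)"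
    using * assms by blast
  thus ?thesis
    using mono [of s t p q] mono [of t s q p] by (cases s t rule: linorder_cases) auto
qed

text \<open>Nearness is expressed by betweenness instead of distance: the minimality clause mentions
  only \<open>x\<close> and \<open>p\<close>, so one point serves all \<open>y\<close> further along
  the same ray.\<close>

definition nearest :: "'a::metric_space set \<Rightarrow> 'a \<Rightarrow> 'a \<Rightarrow> 'a" where
  "nearest A x y = (THE p. p \<in> A \<and> btw x p y \<and> (\<forall>q\<in>A. \<not> btw x q p))"

lemma nearest_eqI:
  fixes x y :: "'a::euclidean_space"
  assumes "p \<in> A" "btw x p y" "\<forall>q\<in>A. \<not> btw x q p"
  shows "nearest A x y = p"
  unfolding nearest_def using assms btw_linear by (intro the_equality) blast+

text \<open>A point of \<open>A\<close> between \<open>x\<close> and \<open>y\<close> at least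
  distance from \<open>x\<close> qualifies: anything in \<open>A\<close> between \<open>x\<close>
  and it would be a closer candidate.\<close>

lemma nearest:
  fixes x y :: "'a::euclidean_space"
  assumes "finite A" "\<exists>p\<in>A. btw x p y"
  shows "nearest A x y \<in> A" "btw x (nearest A x y) y" "q \<in> A \<Longrightarrow> \<not> btw x q (nearest A x y)"
proof -
  define S where "S = {p \<in> A. btw x p y}"
  have "finite S" "S \<noteq> {}"
    using assms by (auto simp: S_def)
  then obtain p where p: "p \<in> S" "\<forall>q\<in>S. dist x p \<le> dist x q"
    using ex_min_if_finite [of "dist x ` S"] by force
  have "\<not> btw x q p" if "q \<in> A" for q
  proof
    assume q: "btw x q p"
    hence "btw x q y"
      using p(1) btw_trans_inner [of y p x q] by (auto simp: S_def btw_commute)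
    hence "dist x p \<le> dist x q"
      using p(2) that by (auto simp: S_def)
    moreover have "dist q p > 0" "dist x p = dist x q + dist q p"
      using q by (auto simp: btw_def)
    ultimately show False
      by linarith
  qed
  moreover from this have "nearest A x y = p"
    using p(1) by (intro nearest_eqI) (auto simp: S_def)
  ultimately show "nearest A x y \<in> A" "btw x (nearest A x y) y"
    "q \<in> A \<Longrightarrow> \<not> btw x q (nearest A x y)"
    using p(1) by (auto simp: S_def)
qed

section \<open>Linear extensions\<close>

lemma lookup_scale_chain [simp]: "Poly_Mapping.lookup (scale_chain c p) s = c * Poly_Mapping.lookup p s"
  by (simp add: scale_chain_def map.rep_eq when_def)

lemma keys_scale_chain: "Poly_Mapping.keys (scale_chain c p) \<subseteq> Poly_Mapping.keys p"
  by (auto simp: in_keys_iff)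

lemma scale_chain_simps [simp]:
  "scale_chain 0 p = 0" "scale_chain c 0 = 0" "scale_chain 1 p = p"
  "scale_chain c (scale_chain d p) = scale_chain (c * d) p"
  "scale_chain (- c) p = - scale_chain c p" "scale_chain c (- p) = - scale_chain c p"
  by (auto intro!: poly_mapping_eqI)

lemma scale_chain_add: "scale_chain c (p + q) = scale_chain c p + scale_chain c q"
  and scale_chain_add_left: "scale_chain (c + d) p = scale_chain c p + scale_chain d p"
  by (auto intro!: poly_mapping_eqI simp: lookup_add algebra_simps)

lemma scale_chain_sum: "scale_chain c (sum f S) = (\<Sum>i\<in>S. scale_chain c (f i))"
  by (induction S rule: infinite_finite_induct) (auto simp: scale_chain_add)

lemma linear_extension_superset:
  assumes "finite S" "Poly_Mapping.keys p \<subseteq> S"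
  shows "linear_extension g p = (\<Sum>s\<in>S. scale_chain (Poly_Mapping.lookup p s) (g s))"
  unfolding linear_extension_def using assms
  by (intro sum.mono_neutral_left) (auto simp: in_keys_iff)

lemma linear_extension_0 [simp]: "linear_extension g 0 = 0"
  by (simp add: linear_extension_def)

lemma linear_extension_single [simp]: "linear_extension g (Poly_Mapping.single s c) = scale_chain c (g s)"
  by (simp add: linear_extension_def)

lemma linear_extension_add:
  "linear_extension g (p + q) = linear_extension g p + linear_extension g q"
proof -
  define S where "S = Poly_Mapping.keys p \<union> Poly_Mapping.keys q"
  have "finite S" "Poly_Mapping.keys p \<subseteq> S" "Poly_Mapping.keys q \<subseteq> S" "Poly_Mapping.keys (p + q) \<subseteq> S"
    using keys_add [of p q] by (auto simp: S_def)
  thus ?thesis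
    by (simp add: linear_extension_superset [of S] lookup_add scale_chain_add_left sum.distrib)
qed

lemma linear_extension_scale:
  "linear_extension g (scale_chain c p) = scale_chain c (linear_extension g p)"
proof -
  have "linear_extension g (scale_chain c p) = (\<Sum>s\<in>Poly_Mapping.keys p. scale_chain (c * Poly_Mapping.lookup p s) (g s))"
    using keys_scale_chain [of c p] by (simp add: linear_extension_superset [of "Poly_Mapping.keys p"])
  thus ?thesis
    by (simp add: linear_extension_def scale_chain_sum)
qed

lemma linear_extension_uminus: "linear_extension g (- p) = - linear_extension g p"
  using linear_extension_scale [of g "-1" p] by simp

lemma linear_extension_diff:
  "linear_extension g (p - q) = linear_extension g p - linear_extension g q"
  using linear_extension_add [of g p "- q"] by (simp add: linear_extension_uminus)

lemma linear_extension_sum: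
  "linear_extension g (sum f S) = (\<Sum>i\<in>S. linear_extension g (f i))"
  by (induction S rule: infinite_finite_induct) (auto simp: linear_extension_add)

lemma linear_extension_linear_extension:
  "linear_extension f (linear_extension g p) = linear_extension (\<lambda>s. linear_extension f (g s)) p"
  unfolding linear_extension_def [of g p] linear_extension_sum linear_extension_scale
  by (simp add: linear_extension_def)

lemma linear_extension_cong:
  "p = q \<Longrightarrow> (\<And>s. s \<in> Poly_Mapping.keys q \<Longrightarrow> f s = g s) \<Longrightarrow> linear_extension f p = linear_extension g q"
  by (simp add: linear_extension_def)

lemma linear_extension_zero [simp]: "linear_extension (\<lambda>s. 0) p = 0"
  by (simp add: linear_extension_def)

lemma linear_extension_fun_uminus:
  "linear_extension (\<lambda>s. - g s) p = - linear_extension g p"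
  by (simp add: linear_extension_def sum_negf)

lemma linear_extension_fun_add:
  "linear_extension (\<lambda>s. f s + g s) p = linear_extension f p + linear_extension g p"
  by (simp add: linear_extension_def scale_chain_add sum.distrib)

lemma linear_extension_ident [simp]: "linear_extension (\<lambda>s. Poly_Mapping.single s 1) p = p"
  by (rule poly_mapping_eqI)
     (simp add: linear_extension_def lookup_sum lookup_single when_def in_keys_iff
       if_distrib [where f = "(*) c" for c] sum.delta' cong: if_cong)

lemma keys_linear_extension: "Poly_Mapping.keys (linear_extension g p) \<subseteq> (\<Union>s\<in>Poly_Mapping.keys p. Poly_Mapping.keys (g s))"
proof
  fix t assume "t \<in> Poly_Mapping.keys (linear_extension g p)"
  then obtain s where "s \<in> Poly_Mapping.keys p" "t \<in> Poly_Mapping.keys (scale_chain (Poly_Mapping.lookup p s) (g s))"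
    unfolding linear_extension_def by (auto dest: subsetD [OF keys_sum])
  thus "t \<in> (\<Union>s\<in>Poly_Mapping.keys p. Poly_Mapping.keys (g s))"
    by (auto dest: subsetD [OF keys_scale_chain])
qed

section \<open>A contracting homotopy off the thin tuples\<close>

lemma path_length_simps [simp]:
  "path_length [] = 0" "path_length [x] = 0"
  "path_length (x # y # r) = dist x y + path_length (y # r)"
  by (simp_all add: path_length_def sum.lessThan_Suc_shift del: sum.lessThan_Suc)

lemma path_length_nonneg: "path_length \<sigma> \<ge> 0"
  by (simp add: path_length_def sum_nonneg)

lemma mag_tuples_iff:
  "\<sigma> \<in> mag_tuples k l Y \<longleftrightarrow>
     length \<sigma> = Suc k \<and> set \<sigma> \<subseteq> Y \<and> distinct_adj \<sigma> \<and> path_length \<sigma> = l"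
  by (auto simp: mag_tuples_def distinct_adj_conv_nth)

lemma mag_tuples_mono: "A \<subseteq> B \<Longrightarrow> mag_tuples k l A \<subseteq> mag_tuples k l B"
  unfolding mag_tuples_def by blast

section \<open>Thin tuples\<close>

fun frame :: "'a::metric_space list \<Rightarrow> bool" where
  "frame (x # y # z # r) \<longleftrightarrow> \<not> btw x y z \<and> frame (y # z # r)"
| "frame _ \<longleftrightarrow> True"

fun gap_points :: "'a::metric_space list \<Rightarrow> 'a set" where
  "gap_points (x # y # r) = {p. btw x p y} \<union> gap_points (y # r)"
| "gap_points _ = {}"

text \<open>The condition is split because \<open>frame\<close> does not depend on \<open>A\<close>,
  while \<open>gap_points\<close> is taken in the whole space: along a filtration only the
  intersection with \<open>A\<close> changes.\<close>

definition thin :: "'a::metric_space set \<Rightarrow> 'a list \<Rightarrow> bool" where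
  "thin A \<sigma> \<longleftrightarrow> frame \<sigma> \<and> gap_points \<sigma> \<inter> A = {}"

lemma thin_Cons:
  "thin A (x # y # r) \<longleftrightarrow>
     (\<forall>p\<in>A. \<not> btw x p y) \<and> (r \<noteq> [] \<longrightarrow> \<not> btw x y (hd r)) \<and> thin A (y # r)"
  by (cases r) (auto simp: thin_def)

section \<open>The boundary by recursion on the tuple\<close>

definition prepend :: "'a \<Rightarrow> ('a list \<Rightarrow>\<^sub>0 'k::field) \<Rightarrow> ('a list \<Rightarrow>\<^sub>0 'k)" where
  "prepend x = linear_extension (\<lambda>\<sigma>. Poly_Mapping.single (x # \<sigma>) 1)"

lemma prepend_simps [simp]:
  "prepend x 0 = 0" "prepend x (- p) = - prepend x p"
  "prepend x (p - q) = prepend x p - prepend x q"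
  "prepend x (p + q) = prepend x p + prepend x q"
  "prepend x (scale_chain c p) = scale_chain c (prepend x p)"
  "prepend x (Poly_Mapping.single \<sigma> c) = Poly_Mapping.single (x # \<sigma>) c"
  by (auto simp: prepend_def linear_extension_uminus linear_extension_diff linear_extension_add linear_extension_scale
      intro!: poly_mapping_eqI) (auto simp: lookup_single when_def)

lemma prepend_sum: "prepend x (sum f S) = (\<Sum>i\<in>S. prepend x (f i))"
  by (simp add: prepend_def linear_extension_sum)

lemma linear_extension_prepend:
  "linear_extension g (prepend x p) = linear_extension (\<lambda>\<sigma>. g (x # \<sigma>)) p"
  by (simp add: prepend_def linear_extension_linear_extension)

lemma prepend_linear_extension:
  "prepend x (linear_extension g p) = linear_extension (\<lambda>\<sigma>. prepend x (g \<sigma>)) p"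
  by (simp add: prepend_def linear_extension_linear_extension)

lemma keys_prepend: "Poly_Mapping.keys (prepend x p) \<subseteq> Cons x ` Poly_Mapping.keys p"
  unfolding prepend_def by (auto dest!: subsetD [OF keys_linear_extension])

text \<open>The boundary of a tuple without equal neighbours. With at least two entries, dropping an
  end shortens the path, so only inner entries count; passing to the tail shifts the indices and
  reverses the sign.\<close>

fun tuple_boundary :: "'a::metric_space list \<Rightarrow> ('a list \<Rightarrow>\<^sub>0 'k::field)" where
  "tuple_boundary (x # y # z # r) = - prepend x (tuple_boundary (y # z # r)) -
     (if btw x y z then Poly_Mapping.single (x # z # r) 1 else 0)"
| "tuple_boundary _ = 0"

lemma omit_simps [simp]:
  "omit 0 (x # \<sigma>) = \<sigma>" "omit (Suc i) (x # \<sigma>) = x # omit i \<sigma>" "omit i [] = []"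
  by (simp_all add: omit_def)

lemma face_0: "distinct_adj \<sigma> \<Longrightarrow> face 0 \<sigma> = 0"
  by (cases \<sigma>; cases "tl \<sigma>") (auto simp: face_def)

lemma face_Suc_Suc:
  "face (Suc (Suc i)) (x # y # z # r) = prepend x (face (Suc i) (y # z # r))"
  by (auto simp: face_def)

lemma face_1:
  assumes "distinct_adj (x # y # z # r)"
  shows "face (Suc 0) (x # y # z # r) = (if btw x y z then Poly_Mapping.single (x # z # r) 1 else 0)"
  using assms by (auto simp: face_def btw_def)

text \<open>The summand with index 0 vanishes, index 1 removes \<open>y\<close>, and the later ones
  are the faces of the tail with \<open>x\<close> in front and the sign reversed.\<close>

lemma sum_face:
  "distinct_adj \<sigma> \<Longrightarrow>
     (\<Sum>i<length \<sigma>. scale_chain ((- 1) ^ i) (face i \<sigma>)) = (tuple_boundary \<sigma> :: 'a::metric_space list \<Rightarrow>\<^sub>0 'k::field)"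
proof (induction \<sigma> rule: tuple_boundary.induct)
  case (1 x y z r)
  define \<tau> where "\<tau> = y # z # r"
  have \<tau>: "distinct_adj \<tau>" "face 0 \<tau> = (0 :: 'a list \<Rightarrow>\<^sub>0 'k)"
    using 1 face_0 [of \<tau>] by (auto simp: \<tau>_def)
  have "(\<Sum>i<length (x # \<tau>). scale_chain ((- 1) ^ i) (face i (x # \<tau>))) =
        (\<Sum>i<length \<tau>. scale_chain ((- 1) ^ Suc i) (face (Suc i) (x # \<tau>)) :: 'a list \<Rightarrow>\<^sub>0 'k)"
    using face_0 [of "x # \<tau>"] 1
    by (simp only: list.size add_Suc_right add_0_right sum.lessThan_Suc_shift) (simp add: \<tau>_def)
  also have "\<dots> = - face (Suc 0) (x # \<tau>) +
        (\<Sum>i<Suc (length r). scale_chain ((- 1) ^ Suc (Suc i)) (face (Suc (Suc i)) (x # \<tau>)))"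
    by (simp add: \<tau>_def sum.lessThan_Suc_shift del: sum.lessThan_Suc)
  also have "(\<Sum>i<Suc (length r). scale_chain ((- 1) ^ Suc (Suc i)) (face (Suc (Suc i)) (x # \<tau>)) :: 'a list \<Rightarrow>\<^sub>0 'k) =
        - prepend x (\<Sum>i<Suc (length r). scale_chain ((- 1) ^ Suc i) (face (Suc i) \<tau>))"
    unfolding \<tau>_def face_Suc_Suc by (simp add: prepend_sum sum_negf del: sum.lessThan_Suc)
  also have "(\<Sum>i<Suc (length r). scale_chain ((- 1) ^ Suc i) (face (Suc i) \<tau>) :: 'a list \<Rightarrow>\<^sub>0 'k) =
        (\<Sum>i<length \<tau>. scale_chain ((- 1) ^ i) (face i \<tau>))"
    using \<tau>(2) by (simp add: \<tau>_def sum.lessThan_Suc_shift del: sum.lessThan_Suc)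
  also have "\<dots> = tuple_boundary \<tau>"
    using 1 by (simp add: \<tau>_def)
  finally show ?case
    using face_1 [OF 1(2)] by (simp add: \<tau>_def)
qed (simp_all add: face_def lessThan_Suc)

lemma boundary_eq:
  assumes "\<And>\<sigma>. \<sigma> \<in> Poly_Mapping.keys p \<Longrightarrow> distinct_adj \<sigma>"
  shows "boundary p = linear_extension tuple_boundary p"
  unfolding boundary_def using assms by (intro linear_extension_cong) (auto simp: sum_face)

text \<open>
  Of the points of \<open>A\<close> between \<open>x\<close> and a point in the direction of \<open>y\<close>, the nearest to \<open>x\<close> can be inserted
  into every tuple that starts at \<open>x\<close> and goes that way: it is the apex of a cone.
\<close>

fun homotopy :: "'a::metric_space set \<Rightarrow> 'a list \<Rightarrow> ('a list \<Rightarrow>\<^sub>0 'k::field)" where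
  "homotopy A (x # y # r) =
     (if \<exists>p\<in>A. btw x p y then - Poly_Mapping.single (x # nearest A x y # y # r) 1
      else if r \<noteq> [] \<and> btw x y (hd r) then 0
      else - prepend x (homotopy A (y # r)))"
| "homotopy A _ = 0"

lemma keys_tuple_boundary_Cons:
  "Poly_Mapping.keys (tuple_boundary (x # y # z # r) :: 'a::metric_space list \<Rightarrow>\<^sub>0 'k::field) \<subseteq>
     Cons x ` Poly_Mapping.keys (tuple_boundary (y # z # r) :: 'a list \<Rightarrow>\<^sub>0 'k) \<union>
     (if btw x y z then {x # z # r} else {})"
  (is "?K \<subseteq> ?L \<union> ?R")
proof
  fix \<tau> assume "\<tau> \<in> ?K"
  hence "\<tau> \<in> Poly_Mapping.keys (prepend x (tuple_boundary (y # z # r)) :: 'a list \<Rightarrow>\<^sub>0 'k) \<or>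
    \<tau> \<in> Poly_Mapping.keys (if btw x y z then Poly_Mapping.single (x # z # r) 1 else 0 :: 'a list \<Rightarrow>\<^sub>0 'k)"
    by (auto simp: in_keys_iff lookup_minus)
  thus "\<tau> \<in> ?L \<union> ?R"
    by (auto dest: subsetD [OF keys_prepend] split: if_splits)
qed

text \<open>The first entry is never dropped, and dropping the second replaces it by a point further
  out in the same direction. This decides which branch of \<open>homotopy\<close> applies to the
  terms of a boundary.\<close>

lemma keys_tuple_boundary:
  "\<tau> \<in> Poly_Mapping.keys (tuple_boundary \<sigma> :: 'a::metric_space list \<Rightarrow>\<^sub>0 'k::field) \<Longrightarrow>
     \<exists>x y z r s. \<sigma> = x # y # r \<and> \<tau> = x # z # s \<and> (z = y \<or> btw x y z)"
proof (induction \<sigma> arbitrary: \<tau> rule: tuple_boundary.induct)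
  case (1 x y z r)
  from subsetD [OF keys_tuple_boundary_Cons 1(2)] show ?case
    using 1(1) by (fastforce split: if_splits)
qed auto

text \<open>Each term has one point of \<open>A\<close> inserted in a gap, so the degree rises by
  one and the path length is kept. By the last clause the second entry can only move towards the
  first; \<open>homotopy_identity\<close> uses this to exclude new faces.\<close>

lemma keys_homotopy:
  fixes \<sigma> :: "'a::euclidean_space list"
  assumes "finite A" "set \<sigma> \<subseteq> A" "distinct_adj \<sigma>"
    and "\<tau> \<in> Poly_Mapping.keys (homotopy A \<sigma> :: 'a list \<Rightarrow>\<^sub>0 'k::field)"
  shows "length \<tau> = Suc (length \<sigma>) \<and> set \<tau> \<subseteq> A \<and> distinct_adj \<tau> \<and> hd \<tau> = hd \<sigma> \<and>
    path_length \<tau> = path_length \<sigma> \<and> (hd (tl \<tau>) = hd (tl \<sigma>) \<or> btw (hd \<sigma>) (hd (tl \<tau>)) (hd (tl \<sigma>)))"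
  using assms
proof (induction \<sigma> arbitrary: \<tau> rule: list.induct)
  case (Cons x \<sigma>)
  show ?case
  proof (cases \<sigma>)
    case (Cons y r)
    show ?thesis
    proof (cases "\<exists>p\<in>A. btw x p y")
      case True
      thus ?thesis
        using nearest [OF Cons.prems(1) True] Cons.prems \<open>\<sigma> = y # r\<close>
        by (auto simp: btw_def)
    next
      case False
      with Cons.prems \<open>\<sigma> = y # r\<close> obtain \<rho> where "\<tau> = x # \<rho>" 
        "\<rho> \<in> Poly_Mapping.keys (homotopy A \<sigma> :: 'a list \<Rightarrow>\<^sub>0 'k)"
        by (auto dest!: subsetD [OF keys_prepend] split: if_splits)
      thus ?thesis
        using Cons.IH [of \<rho>] Cons.prems \<open>\<sigma> = y # r\<close> by (cases \<rho>) auto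
    qed
  qed (use Cons in auto)
qed auto

lemma tuple_boundary_thin: "thin A \<sigma> \<Longrightarrow> tuple_boundary \<sigma> = 0"
  by (induction \<sigma> rule: tuple_boundary.induct) (auto simp: thin_Cons)

lemma prepend_prepend:
  "prepend x (prepend y q) = linear_extension (\<lambda>\<rho>. Poly_Mapping.single (x # y # \<rho>) 1) q"
  by (simp add: prepend_def linear_extension_linear_extension)

text \<open>Induction along the tuple to the first place where a point can be inserted or an entry
  removed. If insertion is possible there, the homotopy is a cone; if only removal is, it kills the
  tuple and puts the removed entry back into one face. Before that place everything commutes with
  \<open>prepend x\<close> up to sign.\<close>

lemma homotopy_identity:
  fixes \<sigma> :: "'a::euclidean_space list"
  assumes "finite A" "set \<sigma> \<subseteq> A" "distinct_adj \<sigma>" "\<not> thin A \<sigma>"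
  shows "linear_extension tuple_boundary (homotopy A \<sigma>) + linear_extension (homotopy A) (tuple_boundary \<sigma>)
    = (Poly_Mapping.single \<sigma> 1 :: 'a list \<Rightarrow>\<^sub>0 'k::field)"
  using assms
proof (induction \<sigma> rule: list.induct)
  case Nil
  thus ?case by (simp add: thin_def)
next
  case (Cons x \<tau>)
  show ?case
  proof (cases \<tau>)
    case Nil
    thus ?thesis using Cons.prems by (simp add: thin_def)
  next
    case \<tau>: (Cons y r)
    have y: "y \<in> A" and dist: "distinct_adj \<tau>" "set \<tau> \<subseteq> A"
      using Cons.prems \<tau> by auto
    let ?d = "tuple_boundary :: 'a list \<Rightarrow> 'a list \<Rightarrow>\<^sub>0 'k"
    let ?h = "homotopy A :: 'a list \<Rightarrow> 'a list \<Rightarrow>\<^sub>0 'k"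
    consider (insert) "\<exists>p\<in>A. btw x p y"
      | (remove) z r' where "\<not> (\<exists>p\<in>A. btw x p y)" "r = z # r'" "btw x y z"
      | (later) "\<not> (\<exists>p\<in>A. btw x p y)" "\<not> (r \<noteq> [] \<and> btw x y (hd r))"
      by (cases r) auto
    thus ?thesis
    proof cases
      case insert
      define p where "p = nearest A x y"
      have p: "p \<in> A" "btw x p y" "\<forall>q\<in>A. \<not> btw x q p"
        using nearest [OF Cons.prems(1) insert] by (auto simp: p_def)
      have h: "?h (x # y # s) = - Poly_Mapping.single (x # p # y # s) 1" for s
        using insert by (simp add: p_def)
      show ?thesis
      proof (cases r)
        case Nil
        thus ?thesis
          using \<tau> h p by (simp add: linear_extension_uminus)
      next
        case r: (Cons z r')
        \<comment> \<open>All terms of \<open>?d \<tau>\<close> begin with \<open>y\<close>, so the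
          same apex \<open>p\<close> is inserted in each.\<close>
        have "linear_extension (\<lambda>\<rho>. ?h (x # \<rho>)) (?d \<tau>) =
          linear_extension (\<lambda>\<rho>. - Poly_Mapping.single (x # p # \<rho>) 1) (?d \<tau>)"
          using \<tau> h by (intro linear_extension_cong) (auto dest!: keys_tuple_boundary)
        hence 1: "linear_extension (\<lambda>\<rho>. ?h (x # \<rho>)) (?d \<tau>) = - prepend x (prepend p (?d \<tau>))"
          by (simp add: linear_extension_fun_uminus prepend_prepend)
        \<comment> \<open>The face without \<open>y\<close> leaves \<open>x\<close> in the same
          direction, hence has the apex \<open>p\<close> as well.\<close>
        have 2: "?h (x # z # r') = - Poly_Mapping.single (x # p # z # r') 1" if "btw x y z"
        proof -
          have "btw x p z"
            using p(2) that btw_trans_inner [of z y x p] by (auto simp: btw_commute)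
          moreover from this have "nearest A x z = p"
            using p by (intro nearest_eqI)
          ultimately show ?thesis
            using p(1) by auto
        qed
        \<comment> \<open>After the insertion of \<open>p\<close>, \<open>y\<close> is removable
          exactly when it was before, so the two terms without \<open>y\<close> cancel.\<close>
        have 3: "btw p y z \<longleftrightarrow> btw x y z"
          using p(2) btw_trans_outer(2) [of x p y z] btw_trans_inner(1) [of z y x p]
          by (metis btw_commute)
        show ?thesis
          using \<tau> r h p 1 2 3
          by (simp add: linear_extension_uminus linear_extension_diff linear_extension_prepend)
      qed
    next
      case remove
      \<comment> \<open>In the terms of \<open>?d \<tau>\<close> the entry after \<open>y\<close> is
        \<open>z\<close> or lies beyond it, so \<open>y\<close> stays removable and the homotopy
        vanishes. What remains is the face \<open>x # z # r'\<close>, into which \<open>y\<close> is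
        reinserted.\<close>
      have "linear_extension (\<lambda>\<rho>. ?h (x # \<rho>)) (?d \<tau>) = linear_extension (\<lambda>\<rho>. 0) (?d \<tau>)"
        using \<tau> remove btw_trans_outer(1) [of x y]
        by (intro linear_extension_cong) (auto dest!: keys_tuple_boundary)
      moreover have "nearest A x z = y"
        using remove y by (intro nearest_eqI) auto
      ultimately show ?thesis
        using \<tau> remove y
        by (auto simp: linear_extension_uminus linear_extension_diff linear_extension_prepend)
    next
      case later
      have not_thin: "\<not> thin A \<tau>"
        using later Cons.prems(4) \<tau> by (auto simp: thin_Cons)
      then obtain z r' where r: "r = z # r'"
        using \<tau> by (cases r) (auto simp: thin_def)
      \<comment> \<open>In a term of \<open>?h \<tau>\<close> the entry after \<open>y\<close> is
        \<open>z\<close> or lies between \<open>y\<close> and \<open>z\<close>. If \<open>y\<close>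
        were between \<open>x\<close> and that entry, it would also be between \<open>x\<close> and
        \<open>z\<close>, against \<open>later\<close>.\<close>
      have "linear_extension (\<lambda>\<rho>. ?d (x # \<rho>)) (?h \<tau>) = linear_extension (\<lambda>\<rho>. - prepend x (?d \<rho>)) (?h \<tau>)"
      proof (rule linear_extension_cong)
        fix \<rho> assume "\<rho> \<in> Poly_Mapping.keys (?h \<tau>)"
        from keys_homotopy [OF Cons.prems(1) dist(2,1) this]
        obtain w s where "\<rho> = y # w # s" "w = z \<or> btw y w z"
          using \<tau> r by (cases \<rho>; cases "tl \<rho>") auto
        moreover from this have "\<not> btw x y w"
          using later r btw_trans_outer(1) [of x y w z] by auto
        ultimately show "?d (x # \<rho>) = - prepend x (?d \<rho>)"
          by simp
      qed simp
      hence 1: "linear_extension (\<lambda>\<rho>. ?d (x # \<rho>)) (?h \<tau>) = - prepend x (linear_extension ?d (?h \<tau>))"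
        by (simp add: linear_extension_fun_uminus prepend_linear_extension)
      \<comment> \<open>Here the entry after \<open>y\<close> is \<open>z\<close> or lies beyond it,
        and \<open>btw_trans_inner\<close> gives the same contradiction.\<close>
      have "linear_extension (\<lambda>\<rho>. ?h (x # \<rho>)) (?d \<tau>) = linear_extension (\<lambda>\<rho>. - prepend x (?h \<rho>)) (?d \<tau>)"
      proof (rule linear_extension_cong)
        fix \<rho> assume "\<rho> \<in> Poly_Mapping.keys (?d \<tau>)"
        from keys_tuple_boundary [OF this]
        obtain w s where "\<rho> = y # w # s" "w = z \<or> btw y z w"
          using \<tau> r by auto
        moreover from this have "\<not> btw x y w"
          using later r btw_trans_inner(1) [of x y w z] by auto
        ultimately show "?h (x # \<rho>) = - prepend x (?h \<rho>)"
          using later by simp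
      qed simp
      hence 2: "linear_extension (\<lambda>\<rho>. ?h (x # \<rho>)) (?d \<tau>) = - prepend x (linear_extension ?h (?d \<tau>))"
        by (simp add: linear_extension_fun_uminus prepend_linear_extension)
      have "?h (x # \<tau>) = - prepend x (?h \<tau>)" "?d (x # \<tau>) = - prepend x (?d \<tau>)"
        using later \<tau> r by auto
      moreover have "prepend x (linear_extension ?d (?h \<tau>)) + prepend x (linear_extension ?h (?d \<tau>)) =
        Poly_Mapping.single (x # \<tau>) 1"
        using Cons.IH [OF Cons.prems(1) dist(2,1) not_thin]
        by (metis prepend_simps(4,6))
      ultimately show ?thesis
        using 1 2 by (simp add: linear_extension_uminus linear_extension_prepend)
    qed
  qed
qed

section \<open>Magnitude homology of finite Euclidean sets\<close>

text \<open>A dropped entry lies strictly between its neighbours, hence in the gap that they form in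
  the face. So no face of a tuple in \<open>A\<close> is thin in \<open>A\<close>.\<close>

lemma gap_points_tuple_boundary:
  "\<rho> \<in> Poly_Mapping.keys (tuple_boundary \<tau> :: 'a::metric_space list \<Rightarrow>\<^sub>0 'k::field) \<Longrightarrow>
     gap_points \<rho> \<inter> set \<tau> \<noteq> {}"
proof (induction \<tau> arbitrary: \<rho> rule: tuple_boundary.induct)
  case (1 x y z r)
  have sub: "gap_points s \<subseteq> gap_points (x # s)" for s
    by (cases s) auto
  from subsetD [OF keys_tuple_boundary_Cons 1(2)] show ?case
  proof
    assume "\<rho> \<in> (#) x ` Poly_Mapping.keys (tuple_boundary (y # z # r) :: 'a list \<Rightarrow>\<^sub>0 'k)"
    then obtain s where "\<rho> = x # s" "gap_points s \<inter> set (y # z # r) \<noteq> {}"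
      using 1(1) by blast
    thus ?thesis
      using sub [of s] by auto
  qed (auto split: if_splits)
qed auto

lemma carrier_MC: "p \<in> carrier (MC k l A) \<longleftrightarrow> Poly_Mapping.keys p \<subseteq> mag_tuples k l A"
  by (simp add: MC_def)

lemma boundary_MC:
  "p \<in> carrier (MC k l A) \<Longrightarrow> boundary p = linear_extension tuple_boundary p"
  by (rule boundary_eq) (auto simp: carrier_MC mag_tuples_iff)

text \<open>Coordinates at thin tuples are therefore well defined on homology classes, which makes
  the classes of distinct thin tuples independent.\<close>

lemma lookup_boundary_thin:
  assumes "p \<in> carrier (MC k l A)" "thin A \<sigma>"
  shows "Poly_Mapping.lookup (boundary p) \<sigma> = 0"
proof (rule ccontr)
  assume "Poly_Mapping.lookup (boundary p) \<sigma> \<noteq> 0"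
  hence "\<sigma> \<in> Poly_Mapping.keys (linear_extension tuple_boundary p)"
    using assms(1) by (simp add: boundary_MC in_keys_iff)
  then obtain \<tau> where \<tau>: "\<tau> \<in> Poly_Mapping.keys p"
    "\<sigma> \<in> Poly_Mapping.keys (tuple_boundary \<tau> :: 'a list \<Rightarrow>\<^sub>0 'b)"
    by (auto dest: subsetD [OF keys_linear_extension])
  have "set \<tau> \<subseteq> A"
    using \<tau>(1) assms(1) unfolding carrier_MC by (auto simp: mag_tuples_iff dest!: subsetD)
  with gap_points_tuple_boundary [OF \<tau>(2)] assms(2) show False
    by (auto simp: thin_def)
qed

text \<open>Without thin coordinates \<open>homotopy_identity\<close> applies to every term; as
  \<open>p\<close> is a cycle, it says that \<open>p\<close> is the boundary of its image
  \<open>q\<close> under the homotopy.\<close>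

lemma cycle_is_boundary:
  fixes A :: "'a::euclidean_space set" and p :: "'a list \<Rightarrow>\<^sub>0 'k::field"
  assumes "finite A" "p \<in> carrier (MC k l A)" "boundary p = 0"
    and "\<And>\<sigma>. thin A \<sigma> \<Longrightarrow> Poly_Mapping.lookup p \<sigma> = 0"
  shows "p \<in> mag_boundaries k l A"
proof -
  define q where "q = linear_extension (homotopy A) p"
  have supp: "set \<sigma> \<subseteq> A" "distinct_adj \<sigma>" "\<not> thin A \<sigma>" "length \<sigma> = Suc k" "path_length \<sigma> = l"
    if "\<sigma> \<in> Poly_Mapping.keys p" for \<sigma>
  proof -
    have "\<sigma> \<in> mag_tuples k l A"
      using that assms(2) by (auto simp: carrier_MC)
    thus "set \<sigma> \<subseteq> A" "distinct_adj \<sigma>" "length \<sigma> = Suc k" "path_length \<sigma> = l"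
      by (simp_all add: mag_tuples_iff)
    show "\<not> thin A \<sigma>"
      using that assms(4) by (auto simp: in_keys_iff)
  qed
  have q: "q \<in> carrier (MC (Suc k) l A)"
    unfolding carrier_MC
  proof
    fix \<tau> assume "\<tau> \<in> Poly_Mapping.keys q"
    then obtain \<sigma> where \<sigma>: "\<sigma> \<in> Poly_Mapping.keys p"
      and \<tau>: "\<tau> \<in> Poly_Mapping.keys (homotopy A \<sigma> :: 'a list \<Rightarrow>\<^sub>0 'k)"
      unfolding q_def by (auto dest: subsetD [OF keys_linear_extension])
    show "\<tau> \<in> mag_tuples (Suc k) l A"
      using keys_homotopy [OF assms(1) supp(1,2) \<tau>, OF \<sigma> \<sigma>] supp(4,5) [OF \<sigma>]
      by (simp add: mag_tuples_iff)
  qed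
  have "boundary q + linear_extension (homotopy A) (boundary p) =
    linear_extension (\<lambda>\<sigma>. linear_extension tuple_boundary (homotopy A \<sigma>) +
      linear_extension (homotopy A) (tuple_boundary \<sigma>)) p"
    by (simp add: boundary_MC [OF q [unfolded q_def]] boundary_MC [OF assms(2)] q_def
        linear_extension_linear_extension linear_extension_fun_add)
  also have "\<dots> = linear_extension (\<lambda>\<sigma>. Poly_Mapping.single \<sigma> 1) p"
    using supp by (intro linear_extension_cong homotopy_identity assms(1)) auto
  finally have "boundary q = p"
    using assms(3) by simp
  thus ?thesis
    using q by (auto simp: mag_boundaries_def)
qed

lemma boundary_thin:
  assumes "\<And>\<sigma>. \<sigma> \<in> Poly_Mapping.keys p \<Longrightarrow> distinct_adj \<sigma> \<and> thin A \<sigma>"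
  shows "boundary p = 0"
proof -
  have "boundary p = linear_extension tuple_boundary p"
    using assms by (intro boundary_eq) auto
  also have "\<dots> = linear_extension (\<lambda>\<sigma>. 0) p"
    using assms by (intro linear_extension_cong) (auto intro: tuple_boundary_thin)
  finally show ?thesis
    by simp
qed

section \<open>Homology classes as cosets of boundaries\<close>

lemma MC_closed:
  "0 \<in> carrier (MC k l A)"
  "p \<in> carrier (MC k l A) \<Longrightarrow> q \<in> carrier (MC k l A) \<Longrightarrow> p + q \<in> carrier (MC k l A)"
  "p \<in> carrier (MC k l A) \<Longrightarrow> q \<in> carrier (MC k l A) \<Longrightarrow> p - q \<in> carrier (MC k l A)"
  "p \<in> carrier (MC k l A) \<Longrightarrow> scale_chain c p \<in> carrier (MC k l A)"
  using keys_add [of p q] keys_diff [of p q] keys_scale_chain [of c p]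
  unfolding carrier_MC by auto

lemma boundary_linear:
  "boundary 0 = 0" "boundary (p + q) = boundary p + boundary q"
  "boundary (p - q) = boundary p - boundary q" "boundary (scale_chain c p) = scale_chain c (boundary p)"
  by (simp_all add: boundary_def linear_extension_add linear_extension_diff linear_extension_scale)

lemma mag_boundaries_closed:
  "0 \<in> mag_boundaries k l A"
  "p \<in> mag_boundaries k l A \<Longrightarrow> q \<in> mag_boundaries k l A \<Longrightarrow> p + q \<in> mag_boundaries k l A"
  "p \<in> mag_boundaries k l A \<Longrightarrow> q \<in> mag_boundaries k l A \<Longrightarrow> p - q \<in> mag_boundaries k l A"
  "p \<in> mag_boundaries k l A \<Longrightarrow> scale_chain c p \<in> mag_boundaries k l A"
proof -
  show "0 \<in> mag_boundaries k l A"
    unfolding mag_boundaries_def using MC_closed(1) boundary_linear(1) by (metis imageI)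
  show "p + q \<in> mag_boundaries k l A" if "p \<in> mag_boundaries k l A" "q \<in> mag_boundaries k l A"
    using that unfolding mag_boundaries_def
    by (elim imageE) (simp add: MC_closed(2) flip: boundary_linear(2))
  show "p - q \<in> mag_boundaries k l A" if "p \<in> mag_boundaries k l A" "q \<in> mag_boundaries k l A"
    using that unfolding mag_boundaries_def
    by (elim imageE) (simp add: MC_closed(3) flip: boundary_linear(3))
  show "scale_chain c p \<in> mag_boundaries k l A" if "p \<in> mag_boundaries k l A"
    using that unfolding mag_boundaries_def
    by (elim imageE) (simp add: MC_closed(4) flip: boundary_linear(4))
qed

lemma mag_boundaries_mono: "A \<subseteq> B \<Longrightarrow> mag_boundaries k l A \<subseteq> mag_boundaries k l B"
  using mag_tuples_mono [of A B "Suc k" l] by (force simp: mag_boundaries_def carrier_MC)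

definition mag_class ::
    "nat \<Rightarrow> real \<Rightarrow> 'a::metric_space set \<Rightarrow> ('a list \<Rightarrow>\<^sub>0 'k::field) \<Rightarrow> ('a list \<Rightarrow>\<^sub>0 'k) set" where
  "mag_class k l A p = {q. q - p \<in> mag_boundaries k l A}"

lemma mag_class_eq_iff: "mag_class k l A p = mag_class k l A q \<longleftrightarrow> p - q \<in> mag_boundaries k l A"
proof
  assume "mag_class k l A p = mag_class k l A q"
  moreover have "p \<in> mag_class k l A p"
    by (simp add: mag_class_def mag_boundaries_closed)
  ultimately show "p - q \<in> mag_boundaries k l A"
    by (simp add: mag_class_def)
next
  assume "p - q \<in> mag_boundaries k l A"
  from mag_boundaries_closed(2) [OF _ this] mag_boundaries_closed(3) [OF _ this]
  have "r - p \<in> mag_boundaries k l A \<longleftrightarrow> r - q \<in> mag_boundaries k l A" for r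
    by (metis (no_types, opaque_lifting) add_diff_cancel diff_add_cancel diff_diff_eq2 diff_add_eq)
  thus "mag_class k l A p = mag_class k l A q"
    by (simp add: mag_class_def)
qed

lemma a_r_coset_mag_boundaries:
  "mag_boundaries k l A +>\<^bsub>mag_cycles k l A\<^esub> p = mag_class k l A p"
proof -
  have "mag_boundaries k l A +>\<^bsub>mag_cycles k l A\<^esub> p = (\<Union>b\<in>mag_boundaries k l A. {b + p})"
    by (simp add: a_r_coset_def' mag_cycles_def MC_def)
  also have "\<dots> = mag_class k l A p"
    by (force simp: mag_class_def)
  finally show ?thesis .
qed

lemma carrier_mag_cycles:
  "p \<in> carrier (mag_cycles k l A) \<longleftrightarrow> p \<in> carrier (MC k l A) \<and> boundary p = 0"
  by (simp add: mag_cycles_def)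

lemma carrier_MH: "carrier (MH k l A) = mag_class k l A ` carrier (mag_cycles k l A)"
  by (auto simp: MH_def quotient_module_def A_RCOSETS_def' a_r_coset_mag_boundaries)

lemma zero_MH: "\<zero>\<^bsub>MH k l A\<^esub> = mag_class k l A 0"
  by (simp add: MH_def quotient_module_def mag_class_def)

lemma add_MH: "mag_class k l A p \<oplus>\<^bsub>MH k l A\<^esub> mag_class k l A q = mag_class k l A (p + q)"
proof -
  have "mag_class k l A p \<oplus>\<^bsub>MH k l A\<^esub> mag_class k l A q =
    (\<Union>r\<in>mag_class k l A p. \<Union>s\<in>mag_class k l A q. {r + s})"
    by (simp add: MH_def quotient_module_def set_add_def' mag_cycles_def MC_def)
  also have "\<dots> = mag_class k l A (p + q)"
  proof (intro subset_antisym subsetI)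
    fix t assume "t \<in> (\<Union>r\<in>mag_class k l A p. \<Union>s\<in>mag_class k l A q. {r + s})"
    then obtain r s where "t = r + s" "r - p \<in> mag_boundaries k l A" "s - q \<in> mag_boundaries k l A"
      by (auto simp: mag_class_def)
    thus "t \<in> mag_class k l A (p + q)"
      using mag_boundaries_closed(2) [of "r - p" k l A "s - q"]
      by (simp add: mag_class_def algebra_simps)
  next
    fix t assume "t \<in> mag_class k l A (p + q)"
    hence "t - q \<in> mag_class k l A p" "q \<in> mag_class k l A q"
      by (simp_all add: mag_class_def mag_boundaries_closed algebra_simps)
    thus "t \<in> (\<Union>r\<in>mag_class k l A p. \<Union>s\<in>mag_class k l A q. {r + s})"
      by force
  qed
  finally show ?thesis .
qed

text \<open>In \<open>quotient_module\<close> and \<open>MH_map\<close> an operation on a class is a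
  union over all its representatives. If the result does not depend on the representative, the union
  is a single class.\<close>

lemma mag_class_absorb:
  assumes "p \<in> S" "\<And>q. q \<in> S \<Longrightarrow> f q - f p \<in> mag_boundaries k l A"
  shows "(\<Union>q\<in>S. mag_class k l A (f q)) = mag_class k l A (f p)"
proof -
  have "mag_class k l A (f q) = mag_class k l A (f p)" if "q \<in> S" for q
    using assms(2) [OF that] by (simp add: mag_class_eq_iff)
  thus ?thesis
    using assms(1) by blast
qed

lemma smult_MH: "c \<odot>\<^bsub>MH k l A\<^esub> mag_class k l A p = mag_class k l A (scale_chain c p)"
proof -
  have "c \<odot>\<^bsub>MH k l A\<^esub> mag_class k l A p =
    (\<Union>q\<in>mag_class k l A p. mag_class k l A (scale_chain c q))"
    by (simp add: MH_def quotient_module_def a_r_coset_mag_boundaries) (simp add: mag_cycles_def MC_def)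
  also have "\<dots> = mag_class k l A (scale_chain c p)"
  proof (rule mag_class_absorb)
    fix q assume "q \<in> mag_class k l A p"
    thus "scale_chain c q - scale_chain c p \<in> mag_boundaries k l A"
      using mag_boundaries_closed(4) [of "q - p" k l A c] scale_chain_add [of c q "- p"]
      by (simp add: mag_class_def)
  qed (simp add: mag_class_def mag_boundaries_closed)
  finally show ?thesis .
qed

lemma MH_map_id:
  assumes "A \<subseteq> A'"
  shows "MH_map k l A' id (mag_class k l A p) = mag_class k l A' p"
proof -
  have "MH_map k l A' id (mag_class k l A p) = (\<Union>q\<in>mag_class k l A p. mag_class k l A' q)"
    by (simp add: MH_map_def a_r_coset_mag_boundaries pushforward_def)
  also have "\<dots> = mag_class k l A' p"
    using mag_boundaries_mono [OF assms]
    by (intro mag_class_absorb) (auto simp: mag_class_def mag_boundaries_closed)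
  finally show ?thesis .
qed

section \<open>Uniqueness of barcodes\<close>

text \<open>Each fibre of \<open>t\<close> is numbered separately, so elements with the same value
  become its numbered copies. This lets tuples index the bars of a barcode.\<close>

lemma ex_instances_enumeration:
  assumes "\<And>x. finite {s \<in> S. t s = x}" "\<And>x. m x = card {s \<in> S. t s = x}"
  obtains e where "bij_betw e S (instances m)" "\<And>s. s \<in> S \<Longrightarrow> fst (e s) = t s"
proof -
  have "\<exists>f. bij_betw f {s \<in> S. t s = x} {0..<m x}" for x
    unfolding assms(2) by (rule ex_bij_betw_finite_nat [OF assms(1)])
  then obtain f where f: "\<And>x. bij_betw (f x) {s \<in> S. t s = x} {0..<m x}"
    by metis
  have "bij_betw (\<lambda>s. (t s, f (t s) s)) S (instances m)"
  proof (rule bij_betwI')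
    fix s s' assume "s \<in> S" "s' \<in> S"
    thus "(t s, f (t s) s) = (t s', f (t s') s') \<longleftrightarrow> s = s'"
      using bij_betw_imp_inj_on [OF f [of "t s"]] by (auto simp: inj_on_def)
  next
    fix s assume "s \<in> S"
    thus "(t s, f (t s) s) \<in> instances m"
      using bij_betwE [OF f [of "t s"]] by (auto simp: instances_def)
  next
    fix \<iota> assume "\<iota> \<in> instances m"
    then obtain x i where xi: "\<iota> = (x, i)" "i \<in> {0..<m x}"
      by (auto simp: instances_def)
    then obtain s where "s \<in> {s \<in> S. t s = x}" "i = f x s"
      using f [of x] by (metis (no_types, lifting) bij_betw_iff_bijections)
    thus "\<exists>s\<in>S. \<iota> = (t s, f (t s) s)"
      using xi by auto
  qed
  thus ?thesis
    by (intro that) auto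
qed

lemma finite_instances_count: "finite (instances (count B))"
proof (rule finite_subset)
  show "instances (count B) \<subseteq> (SIGMA J:set_mset B. {..<count B J})"
    by (auto simp: instances_def intro: count_inI)
qed simp

section \<open>Finite direct sums of interval modules\<close>

definition interval_sum :: "real set multiset \<Rightarrow> ('k::field, real set \<times> nat \<Rightarrow> 'k) pmod" where
  "interval_sum B = pmod_dsum (instances (count B)) (\<lambda>(J, i). interval_pmod J)"

lemma carrier_interval_sum:
  "v \<in> carrier (pmod_space (interval_sum B) a) \<longleftrightarrow>
     v \<in> extensional (instances (count B)) \<and> (\<forall>\<iota>\<in>instances (count B). a \<notin> fst \<iota> \<longrightarrow> v \<iota> = 0)"
  using finite_instances_count [of B]
  by (auto simp: interval_sum_def pmod_dsum_def module_dsum_def interval_pmod_def PiE_def Pi_def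
      split: prod.splits if_splits)

lemma interval_sum_simps:
  "v \<oplus>\<^bsub>pmod_space (interval_sum B) a\<^esub> v' = (\<lambda>\<iota>\<in>instances (count B). v \<iota> + v' \<iota>)"
  "c \<odot>\<^bsub>pmod_space (interval_sum B) a\<^esub> v = (\<lambda>\<iota>\<in>instances (count B). c * v \<iota>)"
  "pmod_map (interval_sum B) a b v =
     (\<lambda>\<iota>\<in>instances (count B). if a \<in> fst \<iota> \<and> b \<in> fst \<iota> then v \<iota> else 0)"
  by (auto simp: interval_sum_def pmod_dsum_def module_dsum_def interval_pmod_def restrict_def
      fun_eq_iff)

lemma interval_sum_closed:
  assumes "v \<in> carrier (pmod_space (interval_sum B) a)"
  shows "v' \<in> carrier (pmod_space (interval_sum B) a) \<Longrightarrow>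
      v \<oplus>\<^bsub>pmod_space (interval_sum B) a\<^esub> v' \<in> carrier (pmod_space (interval_sum B) a)"
    "c \<odot>\<^bsub>pmod_space (interval_sum B) a\<^esub> v \<in> carrier (pmod_space (interval_sum B) a)"
    "pmod_map (interval_sum B) a b v \<in> carrier (pmod_space (interval_sum B) b)"
  using assms by (auto simp: carrier_interval_sum interval_sum_simps)

text \<open>The argument for the inverse needs a source closed under the operations and the
  structure maps. A \<open>pmod\<close> record does not guarantee this by itself, but an interval
  sum has it.\<close>

lemma pmod_isomorphic_interval_sum_sym:
  assumes "pmod_isomorphic (interval_sum B) P"
  shows "pmod_isomorphic P (interval_sum B)"
proof -
  let ?D = "interval_sum B"
  obtain h where iso: "\<And>a. linear_iso (pmod_space ?D a) (pmod_space P a) (h a)"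
    and nat: "\<And>a b x. a \<le> b \<Longrightarrow> x \<in> carrier (pmod_space ?D a) \<Longrightarrow>
      h b (pmod_map ?D a b x) = pmod_map P a b (h a x)"
    using assms unfolding pmod_isomorphic_def by blast
  have bij: "bij_betw (h a) (carrier (pmod_space ?D a)) (carrier (pmod_space P a))" for a
    using iso [of a] by (simp add: linear_iso_def)
  have add: "h a (x \<oplus>\<^bsub>pmod_space ?D a\<^esub> y) = h a x \<oplus>\<^bsub>pmod_space P a\<^esub> h a y"
    if "x \<in> carrier (pmod_space ?D a)" "y \<in> carrier (pmod_space ?D a)" for a x y
    using iso [of a] that by (simp add: linear_iso_def)
  have smult: "h a (c \<odot>\<^bsub>pmod_space ?D a\<^esub> x) = c \<odot>\<^bsub>pmod_space P a\<^esub> h a x"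
    if "x \<in> carrier (pmod_space ?D a)" for a c x
    using iso [of a] that by (simp add: linear_iso_def)
  define h' where "h' = (\<lambda>a. the_inv_into (carrier (pmod_space ?D a)) (h a))"
  have inv: "h' a (h a x) = x" if "x \<in> carrier (pmod_space ?D a)" for a x
    unfolding h'_def using bij [of a] that by (simp add: bij_betw_def the_inv_into_f_f)
  have surj: "\<exists>x'\<in>carrier (pmod_space ?D a). x = h a x'" if "x \<in> carrier (pmod_space P a)" for a x
    using bij_betw_imp_surj_on [OF bij [of a]] that by auto
  have "linear_iso (pmod_space P a) (pmod_space ?D a) (h' a)" for a
    unfolding linear_iso_def
  proof (intro conjI ballI allI)
    show "bij_betw (h' a) (carrier (pmod_space P a)) (carrier (pmod_space ?D a))"
      unfolding h'_def by (rule bij_betw_the_inv_into [OF bij])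
  next
    fix x y assume "x \<in> carrier (pmod_space P a)" "y \<in> carrier (pmod_space P a)"
    thus "h' a (x \<oplus>\<^bsub>pmod_space P a\<^esub> y) = h' a x \<oplus>\<^bsub>pmod_space ?D a\<^esub> h' a y"
      using surj [of x a] surj [of y a] by (auto simp: inv interval_sum_closed simp flip: add)
  next
    fix c x assume "x \<in> carrier (pmod_space P a)"
    thus "h' a (c \<odot>\<^bsub>pmod_space P a\<^esub> x) = c \<odot>\<^bsub>pmod_space ?D a\<^esub> h' a x"
      using surj [of x a] by (auto simp: inv interval_sum_closed simp flip: smult)
  qed
  moreover have "h' b (pmod_map P a b x) = pmod_map ?D a b (h' a x)"
    if "a \<le> b" "x \<in> carrier (pmod_space P a)" for a b x
    using surj [OF that(2)] that(1) by (auto simp: inv interval_sum_closed simp flip: nat)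
  ultimately show ?thesis
    unfolding pmod_isomorphic_def by blast
qed

lemma pmod_isomorphic_trans:
  assumes "pmod_isomorphic P Q" "pmod_isomorphic Q R"
  shows "pmod_isomorphic P R"
proof -
  obtain g where g: "\<And>a. linear_iso (pmod_space P a) (pmod_space Q a) (g a)"
    "\<And>a b x. a \<le> b \<Longrightarrow> x \<in> carrier (pmod_space P a) \<Longrightarrow>
       g b (pmod_map P a b x) = pmod_map Q a b (g a x)"
    using assms(1) unfolding pmod_isomorphic_def by blast
  obtain h where h: "\<And>a. linear_iso (pmod_space Q a) (pmod_space R a) (h a)"
    "\<And>a b x. a \<le> b \<Longrightarrow> x \<in> carrier (pmod_space Q a) \<Longrightarrow>
       h b (pmod_map Q a b x) = pmod_map R a b (h a x)"
    using assms(2) unfolding pmod_isomorphic_def by blast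
  have mem: "g a x \<in> carrier (pmod_space Q a)" if "x \<in> carrier (pmod_space P a)" for a x
    using g(1) [of a] that by (auto simp: linear_iso_def dest: bij_betwE)
  have "linear_iso (pmod_space P a) (pmod_space R a) (h a \<circ> g a)" for a
    using g(1) [of a] h(1) [of a] mem [of _ a]
      bij_betw_trans [of "g a" "carrier (pmod_space P a)" "carrier (pmod_space Q a)" "h a"]
    unfolding linear_iso_def by simp
  moreover have "(h b \<circ> g b) (pmod_map P a b x) = pmod_map R a b ((h a \<circ> g a) x)"
    if "a \<le> b" "x \<in> carrier (pmod_space P a)" for a b x
    using that g(2) h(2) mem by simp
  ultimately show ?thesis
    unfolding pmod_isomorphic_def by (intro exI [of _ "\<lambda>a. h a \<circ> g a"] conjI allI ballI impI)
qed

section \<open>Ranks of structure maps\<close>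

lemma ex_nontrivial_solution:
  fixes M :: "'i \<Rightarrow> 'j \<Rightarrow> 'k::field"
  assumes "finite J" "finite I" "card J < card I"
  shows "\<exists>u. (\<exists>i\<in>I. u i \<noteq> 0) \<and> (\<forall>j\<in>J. (\<Sum>i\<in>I. u i * M i j) = 0)"
  using assms
proof (induction J arbitrary: I M rule: finite_induct)
  case empty
  hence "I \<noteq> {}" by auto
  thus ?case by (intro exI [of _ "\<lambda>_. 1"]) auto
next
  case (insert j0 J)
  show ?case
  proof (cases "\<forall>i\<in>I. M i j0 = 0")
    case True
    have "card J < card I" using insert by simp
    from insert.IH [OF insert.prems(1) this, of M] True show ?thesis by auto
  next
    case False
    then obtain i0 where i0: "i0 \<in> I" "M i0 j0 \<noteq> 0" by auto
    define I' where "I' = I - {i0}"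
    have I': "finite I'" "card J < card I'" "I = insert i0 I'" "i0 \<notin> I'"
      using insert i0 by (auto simp: I'_def)
    define r where "r i = M i j0 / M i0 j0" for i
    from insert.IH [OF I'(1,2), of "\<lambda>i j. M i j - r i * M i0 j"]
    obtain u where u: "\<exists>i\<in>I'. u i \<noteq> 0" "\<forall>j\<in>J. (\<Sum>i\<in>I'. u i * (M i j - r i * M i0 j)) = 0"
      by blast
    \<comment> \<open>The value at the pivot \<open>i0\<close> makes up for the multiples of its row
      that were subtracted from the other rows.\<close>
    define u' where "u' = u(i0 := - (\<Sum>i\<in>I'. u i * r i))"
    have sum: "(\<Sum>i\<in>I. u' i * M i j) = (\<Sum>i\<in>I'. u i * (M i j - r i * M i0 j))" for j
    proof -
      have "(\<Sum>i\<in>I. u' i * M i j) = u' i0 * M i0 j + (\<Sum>i\<in>I'. u' i * M i j)"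
        using I' by simp
      also have "(\<Sum>i\<in>I'. u' i * M i j) = (\<Sum>i\<in>I'. u i * M i j)"
        using I'(4) by (intro sum.cong) (auto simp: u'_def)
      finally show ?thesis
        by (simp add: u'_def sum_distrib_right sum_distrib_left sum_subtractf right_diff_distrib mult.assoc)
    qed
    have "\<forall>j\<in>insert j0 J. (\<Sum>i\<in>I. u' i * M i j) = 0"
      using u(2) i0(2) by (auto simp: sum r_def)
    moreover have "\<exists>i\<in>I. u' i \<noteq> 0"
      using u(1) I'(3,4) by (auto simp: u'_def)
    ultimately show ?thesis by blast
  qed
qed

text \<open>The cardinalities are the ranks of the structure maps from \<open>a\<close> to
  \<open>b\<close>. Otherwise \<open>h b\<close> would map the basis vectors of \<open>?I\<close>
  into a space with fewer coordinates, those in \<open>?J\<close>, contradicting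
  injectivity.\<close>

lemma interval_rank_le:
  fixes B B' :: "real set multiset"
  assumes "pmod_isomorphic (interval_sum B :: ('k::field, real set \<times> nat \<Rightarrow> 'k) pmod)
      (interval_sum B' :: ('k, real set \<times> nat \<Rightarrow> 'k) pmod)"
    and "a \<le> b"
  shows "card {\<iota> \<in> instances (count B). a \<in> fst \<iota> \<and> b \<in> fst \<iota>} \<le>
    card {\<iota> \<in> instances (count B'). a \<in> fst \<iota> \<and> b \<in> fst \<iota>}" (is "card ?I \<le> card ?J")
proof (rule ccontr)
  let ?D = "interval_sum B :: ('k, real set \<times> nat \<Rightarrow> 'k) pmod"
  let ?D' = "interval_sum B' :: ('k, real set \<times> nat \<Rightarrow> 'k) pmod"
  let ?ins = "instances (count B)"
  obtain h where iso: "\<And>a. linear_iso (pmod_space ?D a) (pmod_space ?D' a) (h a)"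
    and nat: "\<And>a b x. a \<le> b \<Longrightarrow> x \<in> carrier (pmod_space ?D a) \<Longrightarrow>
       h b (pmod_map ?D a b x) = pmod_map ?D' a b (h a x)"
    using assms(1) unfolding pmod_isomorphic_def by blast
  have fin: "finite ?I" "finite ?J"
    by (simp_all add: finite_instances_count)
  define vec :: "(real set \<times> nat \<Rightarrow> 'k) \<Rightarrow> (real set \<times> nat) set \<Rightarrow> real set \<times> nat \<Rightarrow> 'k" where
    "vec u F = (\<lambda>\<iota>\<in>?ins. if \<iota> \<in> F then u \<iota> else 0)" for u F
  have vec: "vec u F \<in> carrier (pmod_space ?D c)" if "F \<subseteq> ?I" "c \<in> {a, b}" for u F c
    using that by (auto simp: carrier_interval_sum vec_def)
  \<comment> \<open>A vector supported on \<open>?I\<close> is its own image under the structure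
    map, so by naturality \<open>h b v\<close> lies in the image of the other structure map, which
    vanishes outside \<open>?J\<close>.\<close>
  have supp: "h b v \<iota> = 0" if "v = vec u F" "F \<subseteq> ?I" "\<iota> \<in> instances (count B') - ?J" for u v F \<iota>
  proof -
    have "pmod_map ?D a b v = v"
      using that by (auto simp: interval_sum_simps vec_def fun_eq_iff)
    hence "h b v = pmod_map ?D' a b (h a v)"
      using nat [OF assms(2), of v] vec [of F a u] that by simp
    thus ?thesis
      using that(3) by (auto simp: interval_sum_simps)
  qed
  define M where "M \<iota> = h b (vec (\<lambda>_. 1) {\<iota>})" for \<iota>
  assume "\<not> ?thesis"
  then obtain u where u: "\<exists>\<iota>\<in>?I. u \<iota> \<noteq> 0" "\<forall>\<kappa>\<in>?J. (\<Sum>\<iota>\<in>?I. u \<iota> * M \<iota> \<kappa>) = 0"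
    using ex_nontrivial_solution [OF fin(2,1), of M] by auto
  have hb: "bij_betw (h b) (carrier (pmod_space ?D b)) (carrier (pmod_space ?D' b))"
    and add: "\<And>v w. v \<in> carrier (pmod_space ?D b) \<Longrightarrow> w \<in> carrier (pmod_space ?D b) \<Longrightarrow>
      h b (v \<oplus>\<^bsub>pmod_space ?D b\<^esub> w) = h b v \<oplus>\<^bsub>pmod_space ?D' b\<^esub> h b w"
    and smult: "\<And>c v. v \<in> carrier (pmod_space ?D b) \<Longrightarrow>
      h b (c \<odot>\<^bsub>pmod_space ?D b\<^esub> v) = c \<odot>\<^bsub>pmod_space ?D' b\<^esub> h b v"
    using iso [of b] unfolding linear_iso_def by blast+
  have eval: "h b (vec u F) \<kappa> = (\<Sum>\<iota>\<in>F. u \<iota> * M \<iota> \<kappa>)"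
    if "finite F" "F \<subseteq> ?I" "\<kappa> \<in> instances (count B')" for F \<kappa>
    using that
  proof (induction F rule: finite_induct)
    case empty
    \<comment> \<open>An isomorphism is only known to respect sums and multiples, so the zero vector
      is written as 0 times itself.\<close>
    have "vec u {} = 0 \<odot>\<^bsub>pmod_space ?D b\<^esub> vec u {}"
      by (auto simp: interval_sum_simps vec_def)
    hence "h b (vec u {}) = 0 \<odot>\<^bsub>pmod_space ?D' b\<^esub> h b (vec u {})"
      using smult [of "vec u {}" 0] vec [of "{}" b u] by simp
    hence "h b (vec u {}) \<kappa> = (0 \<odot>\<^bsub>pmod_space ?D' b\<^esub> h b (vec u {})) \<kappa>"
      by (rule fun_cong)
    also have "\<dots> = 0"
      using empty by (simp add: interval_sum_simps)
    finally show ?case by simp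
  next
    case (insert \<iota> F)
    have "vec u (insert \<iota> F) =
      (u \<iota> \<odot>\<^bsub>pmod_space ?D b\<^esub> vec (\<lambda>_. 1) {\<iota>}) \<oplus>\<^bsub>pmod_space ?D b\<^esub> vec u F"
      using insert by (auto simp: interval_sum_simps vec_def fun_eq_iff)
    moreover have "vec (\<lambda>_. 1) {\<iota>} \<in> carrier (pmod_space ?D b)" "vec u F \<in> carrier (pmod_space ?D b)"
      using insert vec by auto
    ultimately have "h b (vec u (insert \<iota> F)) =
      (u \<iota> \<odot>\<^bsub>pmod_space ?D' b\<^esub> M \<iota>) \<oplus>\<^bsub>pmod_space ?D' b\<^esub> h b (vec u F)"
      by (simp add: add smult interval_sum_closed M_def)
    thus ?case
      using insert by (simp add: interval_sum_simps)
  qed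
  have "h b (vec u ?I) \<kappa> = h b (vec u {}) \<kappa>" for \<kappa>
  proof (cases "\<kappa> \<in> instances (count B')")
    case True
    have "h b (vec u ?I) \<kappa> = 0"
    proof (cases "\<kappa> \<in> ?J")
      case True
      thus ?thesis
        using eval [OF fin(1) order.refl \<open>\<kappa> \<in> instances (count B')\<close>] bspec [OF u(2) True] by simp
    next
      case False
      thus ?thesis using supp [of _ u ?I] \<open>\<kappa> \<in> instances (count B')\<close> by blast
    qed
    thus ?thesis
      using eval [of "{}"] True by simp
  next
    case False
    \<comment> \<open>Off the index set every carrier element takes the value
      \<open>undefined\<close>, so the two functions agree there too.\<close>
    have "h b (vec u F) \<kappa> = undefined" if "F \<subseteq> ?I" for F
    proof -
      have "h b (vec u F) \<in> carrier (pmod_space ?D' b)"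
        by (rule bij_betw_apply [OF hb vec [OF that]]) simp
      hence "h b (vec u F) \<in> extensional (instances (count B'))"
        by (simp add: carrier_interval_sum)
      thus ?thesis
        using False by (rule extensional_arb)
    qed
    from this [of ?I] this [of "{}"] show ?thesis
      by simp
  qed
  hence "h b (vec u ?I) = h b (vec u {})" ..
  hence "vec u ?I = vec u {}"
    using bij_betw_imp_inj_on [OF hb] vec [of ?I b u] vec [of "{}" b u] by (auto dest: inj_onD)
  hence eq: "vec u ?I \<iota> = vec u {} \<iota>" for \<iota>
    by simp
  have "u \<iota> = 0" if "\<iota> \<in> ?I" for \<iota>
    using that eq [of \<iota>] by (simp add: vec_def)
  thus False
    using u(1) by blast
qed

lemma card_instances_filter:
  "card {\<iota> \<in> instances (count B). P (fst \<iota>)} = size (filter_mset P B)"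
proof -
  have "{\<iota> \<in> instances (count B). P (fst \<iota>)} =
      (SIGMA J:set_mset (filter_mset P B). {..<count (filter_mset P B) J})"
    by (auto simp: instances_def intro: count_inI)
  thus ?thesis
    by (simp add: size_multiset_overloaded_eq)
qed

text \<open>
  An inclusion-maximal interval \<open>J\<close> on which the multisets disagree contains \<open>a \<le> b\<close> such that no other
  interval of the disagreement contains both, so its multiplicity is a rank.
\<close>

lemma interval_mset_eqI:
  fixes B B' :: "real set multiset"
  assumes int: "\<And>J. J \<in># B + B' \<Longrightarrow> is_interval J \<and> J \<noteq> {}"
    and rank: "\<And>a b. a \<le> b \<Longrightarrow>
      size {#J \<in># B. a \<in> J \<and> b \<in> J#} = size {#J \<in># B'. a \<in> J \<and> b \<in> J#}"
  shows "B = B'"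
proof (rule ccontr)
  assume neq: "B \<noteq> B'"
  define D D' where "D = B - B'" and "D' = B' - B"
  have B: "B = (B \<inter># B') + D" "B' = (B \<inter># B') + D'"
    by (auto simp: D_def D'_def multiset_eq_iff)
  have rank': "size {#J \<in># D. a \<in> J \<and> b \<in> J#} = size {#J \<in># D'. a \<in> J \<and> b \<in> J#}"
    if "a \<le> b" for a b
    using rank [OF that]
    by (subst (asm) B(1), subst (asm) B(2)) simp
  define U where "U = set_mset (D + D')"
  have "U \<noteq> {}"
    using neq B unfolding U_def by auto
  then obtain J where J: "J \<in> U" "\<And>K. K \<in> U \<Longrightarrow> J \<subseteq> K \<Longrightarrow> K = J"
    using finite_has_maximal [of U] by (auto simp: U_def)
  have int': "is_interval K" "K \<noteq> {}" if "K \<in> U" for K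
    using that int [of K] by (auto simp: U_def D_def D'_def dest: in_diffD)
  have "\<exists>x. x \<in> J - K" if "K \<in> U - {J}" for K
    using J that by blast
  \<comment> \<open>\<open>c K\<close> is a point of \<open>J\<close> that \<open>K\<close> misses,
    which exists because \<open>J\<close> is maximal.\<close>
  then obtain c where c: "\<And>K. K \<in> U - {J} \<Longrightarrow> c K \<in> J - K"
    by metis
  obtain x0 where "x0 \<in> J"
    using int' [OF J(1)] by blast
  define P where "P = insert x0 (c ` (U - {J}))"
  have P: "finite P" "P \<noteq> {}" "P \<subseteq> J"
    using c \<open>x0 \<in> J\<close> by (auto simp: P_def U_def)
  \<comment> \<open>An interval containing both extremes of \<open>P\<close> contains all of
    \<open>P\<close>, hence \<open>c K\<close>; so no \<open>K\<close> other than \<open>J\<close>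
    contains both. The point \<open>x0\<close> keeps \<open>P\<close> nonempty.\<close>
  define a b where "a = Min P" and "b = Max P"
  have ab: "a \<in> J" "b \<in> J" "a \<le> b" "\<And>x. x \<in> P \<Longrightarrow> a \<le> x \<and> x \<le> b"
    using P(1) subsetD [OF P(3) Min_in [OF P(1,2)]] subsetD [OF P(3) Max_in [OF P(1,2)]] P(2)
    by (auto simp: a_def b_def)
  have char: "a \<in> K \<and> b \<in> K \<longleftrightarrow> K = J" if "K \<in> U" for K
  proof (cases "K = J")
    case False
    hence cK: "c K \<in> P" "c K \<notin> K"
      using that c [of K] by (auto simp: P_def)
    have "\<not> (a \<in> K \<and> b \<in> K)"
      using int'(1) [OF that] ab(4) [OF cK(1)] cK(2) unfolding is_interval_1 by blast
    thus ?thesis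
      using False by simp
  qed (use ab in auto)
  have "size {#K \<in># E. a \<in> K \<and> b \<in> K#} = count E J" if "set_mset E \<subseteq> U" for E
  proof -
    have "{#K \<in># E. a \<in> K \<and> b \<in> K#} = {#K \<in># E. K = J#}"
      using that char by (intro filter_mset_cong) auto
    thus ?thesis
      by (simp add: filter_eq_replicate_mset)
  qed
  hence "count D J = count D' J"
    using rank' [OF ab(3)] by (simp add: U_def)
  \<comment> \<open>\<open>D\<close> and \<open>D'\<close> are disjoint, so equal counts are both
    zero.\<close>
  hence "count (D + D') J = 0"
    by (auto simp: D_def D'_def)
  thus False
    using J(1) by (simp add: U_def count_eq_zero_iff)
qed

text \<open>The choice in \<open>barcode\<close> is forced: isomorphisms preserve the ranks, and
  these determine the multiset of intervals.\<close>

lemma barcode_eqI: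
  fixes P :: "('k::field, 'v) pmod"
  assumes "\<And>J. J \<in># B \<Longrightarrow> is_interval J \<and> J \<noteq> {}" "pmod_isomorphic (interval_sum B) P"
  shows "barcode P = B"
proof -
  have decomp: "interval_decomposition P B' \<longleftrightarrow>
    (\<forall>J\<in>#B'. is_interval J \<and> J \<noteq> {}) \<and> pmod_isomorphic P (interval_sum B')" for B'
    by (simp add: interval_decomposition_def interval_sum_def instances_def)
  show ?thesis
    unfolding barcode_def
  proof (rule some_equality)
    show "interval_decomposition P B"
      using assms by (simp add: decomp pmod_isomorphic_interval_sum_sym)
  next
    fix B' assume B': "interval_decomposition P B'"
    have iso: "pmod_isomorphic (interval_sum B) (interval_sum B' :: ('k, real set \<times> nat \<Rightarrow> 'k) pmod)"
      using B' assms(2) by (auto simp: decomp intro: pmod_isomorphic_trans)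
    show "B' = B"
    proof (rule interval_mset_eqI)
      fix a b :: real assume "a \<le> b"
      thus "size {#J \<in># B'. a \<in> J \<and> b \<in> J#} = size {#J \<in># B. a \<in> J \<and> b \<in> J#}"
        using interval_rank_le [OF iso, of a b]
          interval_rank_le [OF pmod_isomorphic_interval_sum_sym [OF iso], of a b]
        by (simp add: card_instances_filter [where P = "\<lambda>J. a \<in> J \<and> b \<in> J"])
    qed (use B' assms(1) in \<open>auto simp: decomp\<close>)
  qed
qed

section \<open>The interval decomposition of magnitude homology\<close>

lemma count_image_mset_set:
  assumes "finite S"
  shows "count (image_mset f (mset_set S)) x = card {s \<in> S. f s = x}"
proof -
  have "count (image_mset f (mset_set S)) x = (\<Sum>s\<in>{s \<in> S. f s = x}. count (mset_set S) s)"
    unfolding count_image_mset' using assms by (intro sum.cong) auto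
  also have "\<dots> = (\<Sum>s\<in>{s \<in> S. f s = x}. 1)"
    using assms by (intro sum.cong) auto
  finally show ?thesis
    by simp
qed

text \<open>Distinct points of \<open>X\<close> are at least some \<open>\<epsilon>\<close> apart,
  so each step uses up \<open>\<epsilon>\<close> of the length and \<open>w\<close> bounds the
  number of entries.\<close>

lemma finite_tuples_path_length:
  assumes "finite X"
  shows "finite {\<sigma>. set \<sigma> \<subseteq> X \<and> distinct_adj \<sigma> \<and> path_length \<sigma> \<le> w}"
proof -
  \<comment> \<open>Inserting 1 keeps the minimum meaningful when \<open>X\<close> has fewer than
    two points.\<close>
  define \<epsilon> where "\<epsilon> = Min (insert 1 ((\<lambda>(x, y). dist x y) ` {(x, y). x \<in> X \<and> y \<in> X \<and> x \<noteq> y}))"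
  have fin: "finite {(x, y). x \<in> X \<and> y \<in> X \<and> x \<noteq> y}"
    by (rule finite_subset [of _ "X \<times> X"]) (use assms in auto)
  have "\<epsilon> > 0"
    unfolding \<epsilon>_def using fin by (subst Min_gr_iff) auto
  have le: "\<epsilon> \<le> dist x y" if "x \<in> X" "y \<in> X" "x \<noteq> y" for x y
    unfolding \<epsilon>_def using fin that by (intro Min_le) auto
  have len: "(real (length \<sigma>) - 1) * \<epsilon> \<le> path_length \<sigma>" if "set \<sigma> \<subseteq> X" "distinct_adj \<sigma>" for \<sigma>
    using that
  proof (induction \<sigma> rule: induct_list012)
    case (3 x y r)
    thus ?case
      using le [of x y] by (simp add: algebra_simps)
  qed (use \<open>\<epsilon> > 0\<close> in auto)
  have "{\<sigma>. set \<sigma> \<subseteq> X \<and> distinct_adj \<sigma> \<and> path_length \<sigma> \<le> w} \<subseteq>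
      {\<sigma>. set \<sigma> \<subseteq> X \<and> length \<sigma> \<le> nat \<lceil>w / \<epsilon> + 1\<rceil>}"
  proof safe
    fix \<sigma> assume "set \<sigma> \<subseteq> X" "distinct_adj \<sigma>" "path_length \<sigma> \<le> w"
    with len have "(real (length \<sigma>) - 1) * \<epsilon> \<le> w"
      by force
    hence "real (length \<sigma>) \<le> w / \<epsilon> + 1"
      using \<open>\<epsilon> > 0\<close> by (simp add: field_simps)
    thus "length \<sigma> \<le> nat \<lceil>w / \<epsilon> + 1\<rceil>"
      by linarith
  qed
  thus ?thesis
    using finite_lists_length_le [OF assms] by (rule finite_subset)
qed

definition bar :: "(real \<Rightarrow> 'a::metric_space set) \<Rightarrow> 'a list \<Rightarrow> real set" where
  "bar N \<sigma> = {a. set \<sigma> \<subseteq> N a \<and> gap_points \<sigma> \<inter> N a = {}}"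

text \<open>A nonempty bar confines the entries to the filtration and excludes empty intervals,
  which a barcode may not contain.\<close>

definition bar_tuples :: "(real \<Rightarrow> 'a::metric_space set) \<Rightarrow> real \<Rightarrow> 'a list set" where
  "bar_tuples N w =
     {\<sigma>. \<sigma> \<noteq> [] \<and> distinct_adj \<sigma> \<and> frame \<sigma> \<and> path_length \<sigma> = w \<and> bar N \<sigma> \<noteq> {}}"

lemma finite_bar_tuples:
  assumes "finite X" "\<And>a. N a \<subseteq> X"
  shows "finite (bar_tuples N w)"
  by (rule finite_subset [OF _ finite_tuples_path_length [OF assms(1), of w]])
     (use assms(2) in \<open>fastforce simp: bar_tuples_def bar_def\<close>)

lemma is_interval_bar:
  assumes "mono N"
  shows "is_interval (bar N \<sigma>)"
  unfolding is_interval_1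
proof safe
  fix a b x assume "a \<in> bar N \<sigma>" "b \<in> bar N \<sigma>" "a \<le> x" "x \<le> b"
  thus "x \<in> bar N \<sigma>"
    using monoD [OF assms, of a x] monoD [OF assms, of x b] by (auto simp: bar_def)
qed

text \<open>The isomorphism sends a coordinate vector to the classes of the corresponding
  combinations of thin tuples, one for each degree. Injectivity comes from
  \<open>lookup_boundary_thin\<close>, surjectivity and naturality from
  \<open>cycle_is_boundary\<close>.\<close>

lemma MH_pmod_total_isomorphic:
  fixes N :: "real \<Rightarrow> 'a::euclidean_space set" and w :: real
  assumes "finite X" "\<And>a. N a \<subseteq> X" "mono N"
  shows "pmod_isomorphic (interval_sum (image_mset (bar N) (mset_set (bar_tuples N w))))
    (MH_pmod_total w N :: ('k::field, nat \<Rightarrow> ('a list \<Rightarrow>\<^sub>0 'k) set) pmod)"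
proof -
  define S where "S = bar_tuples N w"
  define B where "B = image_mset (bar N) (mset_set S)"
  let ?D = "interval_sum B :: ('k, real set \<times> nat \<Rightarrow> 'k) pmod"
  let ?P = "MH_pmod_total w N :: ('k, nat \<Rightarrow> ('a list \<Rightarrow>\<^sub>0 'k) set) pmod"
  let ?I = "instances (count B)"
  have finS: "finite S"
    unfolding S_def by (rule finite_bar_tuples [OF assms(1,2)])
  have finN: "finite (N a)" for a
    using assms(1,2) finite_subset by blast
  have "count B J = card {\<sigma> \<in> S. bar N \<sigma> = J}" for J
    unfolding B_def using finS by (rule count_image_mset_set)
  then obtain e where e: "bij_betw e S ?I" "\<And>\<sigma>. \<sigma> \<in> S \<Longrightarrow> fst (e \<sigma>) = bar N \<sigma>"
    using ex_instances_enumeration [of S "bar N" "count B"] finS by auto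
  have eI: "e \<sigma> \<in> ?I" if "\<sigma> \<in> S" for \<sigma>
    using e(1) that by (rule bij_betw_apply)
  have e_surj: "\<exists>\<sigma>\<in>S. \<iota> = e \<sigma>" if "\<iota> \<in> ?I" for \<iota>
    using bij_betw_imp_surj_on [OF e(1)] that by auto
  define chain :: "nat \<Rightarrow> (real set \<times> nat \<Rightarrow> 'k) \<Rightarrow> ('a list \<Rightarrow>\<^sub>0 'k)" where
    "chain k v = (\<Sum>\<sigma>\<in>{\<sigma> \<in> S. length \<sigma> = Suc k}. Poly_Mapping.single \<sigma> (v (e \<sigma>)))" for k v
  have lookup_chain: "Poly_Mapping.lookup (chain k v) \<sigma> = (if \<sigma> \<in> S \<and> length \<sigma> = Suc k then v (e \<sigma>) else 0)"
    for k v \<sigma>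
    using finS by (auto simp: chain_def lookup_sum lookup_single when_def)
  have in_bar: "a \<in> bar N \<sigma>" "\<sigma> \<in> S" "length \<sigma> = Suc k"
    if "v \<in> carrier (pmod_space ?D a)" "\<sigma> \<in> Poly_Mapping.keys (chain k v)" for a k v \<sigma>
    using that e(2) [of \<sigma>] eI [of \<sigma>]
    by (auto simp: in_keys_iff lookup_chain carrier_interval_sum split: if_splits)
  have chain_cycle: "chain k v \<in> carrier (mag_cycles k w (N a))"
    if "v \<in> carrier (pmod_space ?D a)" for a k v
  proof -
    have "boundary (chain k v) = 0"
      using in_bar [OF that] by (intro boundary_thin [where A = "N a"])
        (auto simp: S_def bar_tuples_def bar_def thin_def)
    moreover have "chain k v \<in> carrier (MC k w (N a))"
      using in_bar [OF that] unfolding carrier_MC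
      by (auto simp: S_def bar_tuples_def bar_def mag_tuples_iff)
    ultimately show ?thesis
      by (simp add: carrier_mag_cycles)
  qed
  have in_S: "\<sigma> \<in> S \<and> a \<in> bar N \<sigma> \<and> length \<sigma> = Suc k"
    if "\<sigma> \<in> mag_tuples k w (N a)" "thin (N a) \<sigma>" for \<sigma> a k
    using that by (auto simp: S_def bar_tuples_def mag_tuples_iff thin_def bar_def)
  define g where "g a v = (\<lambda>k. mag_class k w (N a) (chain k v))" for a v
  have carrier_P: "x \<in> carrier (pmod_space ?P a) \<longleftrightarrow>
      (\<forall>k. x k \<in> mag_class k w (N a) ` carrier (mag_cycles k w (N a))) \<and>
      finite {k. x k \<noteq> mag_class k w (N a) 0}" for a x
    by (auto simp: MH_pmod_total_def MH_pmod_def pmod_dsum_def module_dsum_def carrier_MH zero_MH)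
  have g_mem: "g a v \<in> carrier (pmod_space ?P a)" if "v \<in> carrier (pmod_space ?D a)" for a v
  proof -
    have "{k. g a v k \<noteq> mag_class k w (N a) 0} \<subseteq> (\<lambda>\<sigma>. length \<sigma> - 1) ` S"
    proof
      fix k assume "k \<in> {k. g a v k \<noteq> mag_class k w (N a) 0}"
      hence "chain k v \<noteq> 0"
        by (auto simp: g_def)
      then obtain \<sigma> where "Poly_Mapping.lookup (chain k v) \<sigma> \<noteq> 0"
        by (metis lookup_zero poly_mapping_eqI)
      thus "k \<in> (\<lambda>\<sigma>. length \<sigma> - 1) ` S"
        by (auto simp: lookup_chain image_iff intro!: bexI [of _ \<sigma>] split: if_splits)
    qed
    hence "finite {k. g a v k \<noteq> mag_class k w (N a) 0}"
      by (rule finite_subset) (simp add: finS)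
    thus ?thesis
      using chain_cycle [OF that] by (auto simp: carrier_P g_def)
  qed
  have "linear_iso (pmod_space ?D a) (pmod_space ?P a) (g a)" for a
    unfolding linear_iso_def
  proof (intro conjI ballI allI)
    show "bij_betw (g a) (carrier (pmod_space ?D a)) (carrier (pmod_space ?P a))"
    proof (rule bij_betw_imageI)
      show "inj_on (g a) (carrier (pmod_space ?D a))"
      proof (rule inj_onI)
        fix v v' assume v: "v \<in> carrier (pmod_space ?D a)" "v' \<in> carrier (pmod_space ?D a)"
          "g a v = g a v'"
        have bd: "chain k v - chain k v' \<in> mag_boundaries k w (N a)" for k
          using fun_cong [OF v(3), of k] by (simp add: g_def mag_class_eq_iff)
        show "v = v'"
        proof
          fix \<iota> show "v \<iota> = v' \<iota>"
          proof (cases "\<iota> \<in> ?I \<and> a \<in> fst \<iota>")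
            case True
            then obtain \<sigma> where \<sigma>: "\<sigma> \<in> S" "\<iota> = e \<sigma>" "a \<in> bar N \<sigma>"
              using e_surj [of \<iota>] e(2) by auto
            then obtain k where k: "length \<sigma> = Suc k"
              by (cases \<sigma>) (auto simp: S_def bar_tuples_def)
            have "thin (N a) \<sigma>"
              using \<sigma> by (auto simp: S_def bar_tuples_def bar_def thin_def)
            with bd [of k] have "Poly_Mapping.lookup (chain k v - chain k v') \<sigma> = 0"
              by (auto simp: mag_boundaries_def lookup_boundary_thin)
            thus ?thesis
              using \<sigma> k by (simp add: lookup_minus lookup_chain)
          next
            case False
            thus ?thesis
              using v(1,2) unfolding carrier_interval_sum by (metis extensional_arb)
          qed
        qed
      qed
    next
      show "g a ` carrier (pmod_space ?D a) = carrier (pmod_space ?P a)"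
      proof (intro subset_antisym subsetI)
        fix x assume "x \<in> carrier (pmod_space ?P a)"
        hence "\<forall>k. \<exists>p\<in>carrier (mag_cycles k w (N a)). x k = mag_class k w (N a) p"
          unfolding carrier_P by blast
        then obtain p where p: "\<And>k. p k \<in> carrier (mag_cycles k w (N a))"
          "\<And>k. x k = mag_class k w (N a) (p k)"
          by metis
        \<comment> \<open>\<open>v\<close> collects the coordinates of the cycles \<open>p k\<close>
          at thin tuples; a tuple of degree \<open>k\<close> has length \<open>k + 1\<close>, whence
          \<open>length \<sigma> - 1\<close>.\<close>
        define v where "v = (\<lambda>\<iota>\<in>?I. let \<sigma> = the_inv_into S e \<iota> in
          if a \<in> bar N \<sigma> then Poly_Mapping.lookup (p (length \<sigma> - 1)) \<sigma> else 0)"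
        have v_e: "v (e \<sigma>) = (if a \<in> bar N \<sigma> then Poly_Mapping.lookup (p (length \<sigma> - 1)) \<sigma> else 0)"
          if "\<sigma> \<in> S" for \<sigma>
          using that e(1) eI by (simp add: v_def the_inv_into_f_f bij_betw_def)
        have v: "v \<in> carrier (pmod_space ?D a)"
          unfolding carrier_interval_sum
        proof (intro conjI ballI impI)
          fix \<iota> assume "\<iota> \<in> ?I" "a \<notin> fst \<iota>"
          then obtain \<sigma> where "\<sigma> \<in> S" "\<iota> = e \<sigma>" "a \<notin> bar N \<sigma>"
            using e_surj [of \<iota>] e(2) by auto
          thus "v \<iota> = 0"
            using v_e by simp
        qed (simp add: v_def)
        have "p k - chain k v \<in> mag_boundaries k w (N a)" for k
        proof (rule cycle_is_boundary)
          show MC: "p k - chain k v \<in> carrier (MC k w (N a))" and "boundary (p k - chain k v) = 0"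
            using p(1) [of k] chain_cycle [OF v, of k]
            by (auto simp: carrier_mag_cycles MC_closed boundary_linear)
          fix \<sigma> assume thin: "thin (N a) \<sigma>"
          show "Poly_Mapping.lookup (p k - chain k v) \<sigma> = 0"
          proof (cases "\<sigma> \<in> mag_tuples k w (N a)")
            case True
            from in_S [OF this thin] show ?thesis
              by (simp add: lookup_minus lookup_chain v_e)
          next
            case False
            thus ?thesis
              using MC unfolding carrier_MC by (auto simp: in_keys_iff)
          qed
        qed (rule finN)
        hence "x = g a v"
          unfolding g_def by (intro ext) (simp add: p(2) mag_class_eq_iff)
        thus "x \<in> g a ` carrier (pmod_space ?D a)"
          using v by blast
      qed (use g_mem in auto)
    qed
  next
    fix v v'
    have "chain k (v \<oplus>\<^bsub>pmod_space ?D a\<^esub> v') = chain k v + chain k v'" for k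
      by (rule poly_mapping_eqI) (simp add: lookup_add lookup_chain interval_sum_simps eI)
    thus "g a (v \<oplus>\<^bsub>pmod_space ?D a\<^esub> v') = g a v \<oplus>\<^bsub>pmod_space ?P a\<^esub> g a v'"
      by (simp add: g_def MH_pmod_total_def MH_pmod_def pmod_dsum_def module_dsum_def add_MH restrict_def)
  next
    fix c v
    have "chain k (c \<odot>\<^bsub>pmod_space ?D a\<^esub> v) = scale_chain c (chain k v)" for k
      by (rule poly_mapping_eqI) (simp add: lookup_chain interval_sum_simps eI)
    thus "g a (c \<odot>\<^bsub>pmod_space ?D a\<^esub> v) = c \<odot>\<^bsub>pmod_space ?P a\<^esub> g a v"
      by (simp add: g_def MH_pmod_total_def MH_pmod_def pmod_dsum_def module_dsum_def smult_MH restrict_def)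
  qed
  moreover have "g b (pmod_map ?D a b v) = pmod_map ?P a b (g a v)"
    if "a \<le> b" and v: "v \<in> carrier (pmod_space ?D a)" for a b v
  proof -
    have sub: "N a \<subseteq> N b"
      using assms(3) \<open>a \<le> b\<close> by (rule monoD)
    \<comment> \<open>The structure map deletes the tuples whose bars have ended by
      \<open>b\<close>. They are no longer thin, so the difference has no thin coordinates and is a
      boundary.\<close>
    have "chain k (pmod_map ?D a b v) - chain k v \<in> mag_boundaries k w (N b)" for k
    proof (rule cycle_is_boundary)
      have "chain k v \<in> carrier (mag_cycles k w (N b))"
        using chain_cycle [OF v, of k] mag_tuples_mono [OF sub]
        by (auto simp: carrier_mag_cycles carrier_MC)
      moreover have "chain k (pmod_map ?D a b v) \<in> carrier (mag_cycles k w (N b))"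
        by (intro chain_cycle interval_sum_closed v)
      ultimately show "chain k (pmod_map ?D a b v) - chain k v \<in> carrier (MC k w (N b))"
        and "boundary (chain k (pmod_map ?D a b v) - chain k v) = 0"
        by (auto simp: carrier_mag_cycles MC_closed boundary_linear)
      fix \<sigma> assume "thin (N b) \<sigma>"
      hence "b \<in> bar N \<sigma>" if "a \<in> bar N \<sigma>"
        using that sub by (auto simp: bar_def thin_def)
      thus "Poly_Mapping.lookup (chain k (pmod_map ?D a b v) - chain k v) \<sigma> = 0"
        using v by (auto simp: lookup_minus lookup_chain interval_sum_simps carrier_interval_sum e(2) eI)
    qed (rule finN)
    hence "g b (pmod_map ?D a b v) = (\<lambda>k. mag_class k w (N b) (chain k v))"
      unfolding g_def by (intro ext) (simp add: mag_class_eq_iff)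
    also have "\<dots> = pmod_map ?P a b (g a v)"
      by (simp add: g_def MH_pmod_total_def MH_pmod_def pmod_dsum_def MH_map_id [OF sub] restrict_def)
    finally show ?thesis .
  qed
  ultimately show ?thesis
    unfolding pmod_isomorphic_def B_def [symmetric] S_def [symmetric] by blast
qed

section \<open>Bottleneck stability\<close>

definition all_bars :: "(real \<Rightarrow> 'a::metric_space set) \<Rightarrow> 'a list set" where
  "all_bars N = {\<sigma>. \<sigma> \<noteq> [] \<and> distinct_adj \<sigma> \<and> frame \<sigma> \<and> bar N \<sigma> \<noteq> {}}"

lemma barcode_MH_pmod_total:
  fixes N :: "real \<Rightarrow> 'a::euclidean_space set"
  assumes "finite X" "\<And>a. N a \<subseteq> X" "mono N"
  shows "barcode (MH_pmod_total w N :: ('k::field, nat \<Rightarrow> ('a list \<Rightarrow>\<^sub>0 'k) set) pmod) =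
    image_mset (bar N) (mset_set (bar_tuples N w))"
proof (rule barcode_eqI)
  show "is_interval J \<and> J \<noteq> {}" if "J \<in># image_mset (bar N) (mset_set (bar_tuples N w))" for J
    using that finite_bar_tuples [OF assms(1,2)] is_interval_bar [OF assms(3)]
    by (auto simp: bar_tuples_def)
qed (rule MH_pmod_total_isomorphic [OF assms])

text \<open>Each weight admits finitely many tuples, so the fibres are finite and the copies of
  weighted bars can be labelled by tuples. The labels make bars of different filtrations
  comparable.\<close>

lemma weighted_barcode_enumeration:
  fixes N :: "real \<Rightarrow> 'a::euclidean_space set"
  assumes "finite X" "\<And>a. N a \<subseteq> X" "mono N"
  obtains e where "bij_betw e (all_bars N) (instances (weighted_barcode TYPE('k::field) N))"
    "\<And>\<sigma>. \<sigma> \<in> all_bars N \<Longrightarrow> fst (e \<sigma>) = (birth_death (bar N \<sigma>), path_length \<sigma>)"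
proof -
  define t where "t \<sigma> = (birth_death (bar N \<sigma>), path_length \<sigma>)" for \<sigma>
  have fin: "finite (bar_tuples N w)" for w
    by (rule finite_bar_tuples [OF assms(1,2)])
  have eq: "{\<sigma> \<in> all_bars N. t \<sigma> = (bd, w)} = {\<sigma> \<in> bar_tuples N w. birth_death (bar N \<sigma>) = bd}" for bd w
    by (auto simp: all_bars_def bar_tuples_def t_def)
  have "weighted_barcode TYPE('k) N (bd, w) = card {\<sigma> \<in> all_bars N. t \<sigma> = (bd, w)}" for bd w
  proof (cases "w \<ge> 0")
    case True
    have "weighted_barcode TYPE('k) N (bd, w) =
      count (image_mset (birth_death \<circ> bar N) (mset_set (bar_tuples N w))) bd"
      using True by (simp add: weighted_barcode_def barcode_MH_pmod_total [OF assms]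
          image_mset.compositionality)
    also have "\<dots> = card {\<sigma> \<in> all_bars N. t \<sigma> = (bd, w)}"
      unfolding count_image_mset_set [OF fin] eq by simp
    finally show ?thesis .
  next
    case False
    hence "bar_tuples N w = {}"
      using path_length_nonneg by (auto simp: bar_tuples_def)
    thus ?thesis
      using False by (simp add: weighted_barcode_def eq)
  qed
  hence count: "weighted_barcode TYPE('k) N x = card {\<sigma> \<in> all_bars N. t \<sigma> = x}" for x
    by (cases x) simp
  have fin': "finite {\<sigma> \<in> all_bars N. t \<sigma> = x}" for x
    using fin by (cases x) (simp add: eq)
  obtain e where "bij_betw e (all_bars N) (instances (weighted_barcode TYPE('k) N))"
    "\<And>\<sigma>. \<sigma> \<in> all_bars N \<Longrightarrow> fst (e \<sigma>) = t \<sigma>"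
    using ex_instances_enumeration [OF fin' count] by blast
  thus ?thesis
    using that by (simp add: t_def)
qed

text \<open>A bar is a difference of up-sets: \<open>U\<close>, where all entries are present, minus
  \<open>V\<close>, where a gap is occupied. It begins where \<open>U\<close> begins and ends where
  \<open>V\<close> begins; an empty \<open>V\<close> gives an infinite death time.\<close>

lemma birth_death_Diff:
  fixes U V :: "real set"
  assumes U: "\<And>x y. x \<in> U \<Longrightarrow> x \<le> y \<Longrightarrow> y \<in> U" and V: "\<And>x y. x \<in> V \<Longrightarrow> x \<le> y \<Longrightarrow> y \<in> V"
    and "U - V \<noteq> {}"
  shows "birth_death (U - V) = (Inf (ereal ` U), Inf (ereal ` V))"
proof -
  obtain c where c: "c \<in> U" "c \<notin> V"
    using assms(3) by blast
  have "Inf (ereal ` (U - V)) = Inf (ereal ` U)"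
  proof (rule antisym)
    show "Inf (ereal ` (U - V)) \<le> Inf (ereal ` U)"
    proof (rule Inf_greatest, safe)
      fix u assume "u \<in> U"
      hence "min u c \<in> U - V"
        using c V [of "min u c" c] by (auto simp: min_def)
      hence "Inf (ereal ` (U - V)) \<le> ereal (min u c)"
        by (intro Inf_lower imageI)
      thus "Inf (ereal ` (U - V)) \<le> ereal u"
        by (rule order_trans) simp
    qed
  qed (auto intro: Inf_superset_mono)
  moreover have "Sup (ereal ` (U - V)) = Inf (ereal ` V)"
  proof (rule antisym)
    show "Sup (ereal ` (U - V)) \<le> Inf (ereal ` V)"
    proof (rule Sup_least, rule Inf_greatest, safe)
      fix x v assume "v \<in> V" "x \<notin> V"
      thus "ereal x \<le> ereal v"
        using V [of v x] by (cases "x \<le> v") auto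
    qed
    show "Inf (ereal ` V) \<le> Sup (ereal ` (U - V))"
    proof (rule ccontr)
      assume "\<not> ?thesis"
      \<comment> \<open>A level strictly between the two bounds is a real number above
        \<open>c\<close>, hence in \<open>U\<close> but not in \<open>V\<close>, contradicting the
        supremum.\<close>
      then obtain y where y: "Sup (ereal ` (U - V)) < y" "y < Inf (ereal ` V)"
        using dense by (metis not_le)
      have "ereal c \<le> Sup (ereal ` (U - V))"
        using c by (intro Sup_upper imageI) auto
      hence "ereal c < y"
        using y(1) by (rule le_less_trans)
      with y(2) obtain r where r: "y = ereal r" "c < r"
        by (cases y) auto
      have "r \<in> U"
        using U [of c r] c r by simp
      moreover have "r \<notin> V"
      proof
        assume "r \<in> V"
        hence "Inf (ereal ` V) \<le> ereal r"
          by (intro Inf_lower imageI)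
        thus False using y r by simp
      qed
      ultimately have "ereal r \<le> Sup (ereal ` (U - V))"
        by (intro Sup_upper imageI) auto
      thus False
        using y r by simp
    qed
  qed
  ultimately show ?thesis
    by (simp add: birth_death_def)
qed

lemma Inf_shift_le:
  fixes U U' :: "real set"
  assumes "\<And>x. x \<in> U \<Longrightarrow> x + \<delta> \<in> U'"
  shows "Inf (ereal ` U') \<le> Inf (ereal ` U) + ereal \<delta>"
proof -
  have "Inf (ereal ` U') - ereal \<delta> \<le> Inf (ereal ` U)"
  proof (rule Inf_greatest, safe)
    fix u assume "u \<in> U"
    hence "Inf (ereal ` U') \<le> ereal (u + \<delta>)"
      using assms by (intro Inf_lower imageI)
    thus "Inf (ereal ` U') - ereal \<delta> \<le> ereal u"
      by (cases "Inf (ereal ` U')") auto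
  qed
  thus ?thesis
    by (cases "Inf (ereal ` U')"; cases "Inf (ereal ` U)") auto
qed

text \<open>The two bounds force infinite endpoints to agree, and for equal ones
  \<open>endpoint_dist\<close> is 0.\<close>

lemma endpoint_dist_le:
  assumes "x \<le> y + ereal \<delta>" "y \<le> x + ereal \<delta>" "\<delta> \<ge> 0"
  shows "endpoint_dist x y \<le> ereal \<delta>"
  using assms by (cases x; cases y) (auto simp: endpoint_dist_def)

text \<open>Interleaving moves both endpoints of the bar of a tuple by at most
  \<open>\<delta>\<close>. Its weight is the path length, which depends on the tuple alone, so
  matching along tuples preserves weights.\<close>

lemma bottleneck_dist_interleaved_le:
  fixes N N' :: "real \<Rightarrow> 'a::euclidean_space set"
  assumes X: "finite X" "\<And>a. N a \<subseteq> X" "\<And>a. N' a \<subseteq> X" and mono: "mono N" "mono N'"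
    and empty: "\<And>a. a \<le> 0 \<Longrightarrow> N a = {}" "\<And>a. a \<le> 0 \<Longrightarrow> N' a = {}"
    and inter: "\<And>a. N a \<subseteq> N' (a + \<delta>)" "\<And>a. N' a \<subseteq> N (a + \<delta>)" and "\<delta> \<ge> 0"
  shows "bottleneck_dist (weighted_barcode TYPE('k::field) N) (weighted_barcode TYPE('k) N') \<le> ereal \<delta>"
proof -
  let ?B = "weighted_barcode TYPE('k) N" and ?B' = "weighted_barcode TYPE('k) N'"
  obtain e where e: "bij_betw e (all_bars N) (instances ?B)"
    "\<And>\<sigma>. \<sigma> \<in> all_bars N \<Longrightarrow> fst (e \<sigma>) = (birth_death (bar N \<sigma>), path_length \<sigma>)"
    using weighted_barcode_enumeration [OF X(1,2) mono(1)] by blast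
  obtain e' where e': "bij_betw e' (all_bars N') (instances ?B')"
    "\<And>\<sigma>. \<sigma> \<in> all_bars N' \<Longrightarrow> fst (e' \<sigma>) = (birth_death (bar N' \<sigma>), path_length \<sigma>)"
    using weighted_barcode_enumeration [OF X(1,3) mono(2)] by blast
  define birth where "birth N \<sigma> = Inf (ereal ` {a. set \<sigma> \<subseteq> N a})" for N :: "real \<Rightarrow> 'a set" and \<sigma>
  define death where "death N \<sigma> = Inf (ereal ` {a. gap_points \<sigma> \<inter> N a \<noteq> {}})"
    for N :: "real \<Rightarrow> 'a set" and \<sigma>
  have bar: "bar N \<sigma> = {a. set \<sigma> \<subseteq> N a} - {a. gap_points \<sigma> \<inter> N a \<noteq> {}}"
    for N :: "real \<Rightarrow> 'a set" and \<sigma>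
    by (auto simp: bar_def)
  have bd: "birth_death (bar N \<sigma>) = (birth N \<sigma>, death N \<sigma>)"
    if "mono N" "\<sigma> \<in> all_bars N" for N \<sigma>
    unfolding bar birth_def death_def
  proof (rule birth_death_Diff)
    show "{a. set \<sigma> \<subseteq> N a} - {a. gap_points \<sigma> \<inter> N a \<noteq> {}} \<noteq> {}"
      using that(2) unfolding all_bars_def bar [symmetric] by simp
  qed (use monoD [OF that(1)] in blast)+
  have shift: "birth L' \<sigma> \<le> birth L \<sigma> + ereal \<delta>" "death L' \<sigma> \<le> death L \<sigma> + ereal \<delta>"
    if "\<And>a. L a \<subseteq> L' (a + \<delta>)" for L L' \<sigma>
    unfolding birth_def death_def using that by (intro Inf_shift_le; blast)+
  \<comment> \<open>Passing to \<open>L'\<close>, where the tuple has no bar, and back gives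
    \<open>death L \<sigma> \<le> death L' \<sigma> + \<delta> \<le> birth L' \<sigma> + \<delta>
    \<le> birth L \<sigma> + 2\<delta>\<close>.\<close>
  have unmatched: "(death L \<sigma> - birth L \<sigma>) / 2 \<le> ereal \<delta>"
    if "\<sigma> \<in> all_bars L" "\<sigma> \<notin> all_bars L'" "\<And>a. L a \<subseteq> L' (a + \<delta>)" "\<And>a. L' a \<subseteq> L (a + \<delta>)"
      "\<And>a. a \<le> 0 \<Longrightarrow> L a = {}" for L L' \<sigma>
  proof -
    have \<sigma>: "\<sigma> \<noteq> []" "bar L \<sigma> \<noteq> {}" "bar L' \<sigma> = {}"
      using that(1,2) by (auto simp: all_bars_def)
    \<comment> \<open>In \<open>L'\<close> a gap is occupied at every level where all entries are
      present, so the infimum defining the death is over a larger set.\<close>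
    have "death L' \<sigma> \<le> birth L' \<sigma>"
      unfolding death_def birth_def using \<sigma>(3) by (intro Inf_superset_mono image_mono) (auto simp: bar)
    hence 1: "death L \<sigma> \<le> birth L \<sigma> + ereal \<delta> + ereal \<delta>"
      using shift(2) [where L = L' and L' = L, OF that(4), of \<sigma>]
        shift(1) [where L = L and L' = L', OF that(3), of \<sigma>]
      by (meson add_right_mono order_trans)
    obtain c where "set \<sigma> \<subseteq> L c"
      using \<sigma>(2) by (auto simp: bar_def)
    hence "birth L \<sigma> \<le> ereal c"
      unfolding birth_def by (intro Inf_lower) auto
    \<comment> \<open>Emptiness at levels up to 0 bounds the birth time below. Being real, it can be
      subtracted in the estimate for \<open>death L \<sigma>\<close>.\<close>
    moreover have "0 \<le> birth L \<sigma>"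
      unfolding birth_def
    proof (rule Inf_greatest, safe)
      fix a assume "set \<sigma> \<subseteq> L a"
      thus "0 \<le> ereal a"
        using that(5) [of a] \<sigma>(1) by (cases "a \<le> 0") auto
    qed
    ultimately obtain b where "birth L \<sigma> = ereal b"
      by (cases "birth L \<sigma>") auto
    thus ?thesis
      using 1 by (cases "death L \<sigma>") auto
  qed
  \<comment> \<open>A tuple is matched exactly when it has a bar in both filtrations.\<close>
  define M where "M = (\<lambda>\<sigma>. (e \<sigma>, e' \<sigma>)) ` (all_bars N \<inter> all_bars N')"
  have dom: "Domain M = e ` (all_bars N \<inter> all_bars N')" "Range M = e' ` (all_bars N \<inter> all_bars N')"
    by (simp_all add: M_def Domain_fst Range_snd image_image)
  have inj: "inj_on e (all_bars N)" "inj_on e' (all_bars N')"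
    using e(1) e'(1) by (auto simp: bij_betw_def)
  have "weight_matching ?B ?B' M"
    unfolding weight_matching_def
  proof (intro conjI)
    show "M \<subseteq> instances ?B \<times> instances ?B'"
      using bij_betwE [OF e(1)] bij_betwE [OF e'(1)] by (auto simp: M_def)
    show "single_valued M"
    proof (rule single_valuedI)
      fix s t t' assume "(s, t) \<in> M" "(s, t') \<in> M"
      then obtain \<sigma> \<tau> where "\<sigma> \<in> all_bars N" "\<tau> \<in> all_bars N" "s = e \<sigma>" "s = e \<tau>"
        and t: "t = e' \<sigma>" "t' = e' \<tau>"
        unfolding M_def by blast
      hence "\<sigma> = \<tau>"
        by (intro inj_onD [OF inj(1)]) simp_all
      thus "t = t'"
        by (simp add: t)
    qed
    show "single_valued (M\<inverse>)"
    proof (rule single_valuedI)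
      fix s t t' assume "(s, t) \<in> M\<inverse>" "(s, t') \<in> M\<inverse>"
      then obtain \<sigma> \<tau> where "\<sigma> \<in> all_bars N'" "\<tau> \<in> all_bars N'" "s = e' \<sigma>" "s = e' \<tau>"
        and t: "t = e \<sigma>" "t' = e \<tau>"
        unfolding M_def by blast
      hence "\<sigma> = \<tau>"
        by (intro inj_onD [OF inj(2)]) simp_all
      thus "t = t'"
        by (simp add: t)
    qed
    show "\<forall>(s, t)\<in>M. snd (fst s) = snd (fst t)"
      by (auto simp: M_def e(2) e'(2))
  qed
  hence "bottleneck_dist ?B ?B' \<le> matching_cost ?B ?B' M"
    unfolding bottleneck_dist_def by (intro Inf_lower) blast
  also have "\<dots> \<le> ereal \<delta>"
    unfolding matching_cost_def
  proof (rule Sup_least)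
    fix c assume "c \<in> {0} \<union> {matched_cost (fst s) (fst t) | s t. (s, t) \<in> M}
      \<union> {unmatched_cost (fst s) | s. s \<in> instances ?B - Domain M}
      \<union> {unmatched_cost (fst t) | t. t \<in> instances ?B' - Range M}"
    then consider "c = 0" | s t where "c = matched_cost (fst s) (fst t)" "(s, t) \<in> M"
      | s where "c = unmatched_cost (fst s)" "s \<in> instances ?B" "s \<notin> Domain M"
      | s where "c = unmatched_cost (fst s)" "s \<in> instances ?B'" "s \<notin> Range M"
      by blast
    thus "c \<le> ereal \<delta>"
    proof cases
      case 1
      thus ?thesis using \<open>\<delta> \<ge> 0\<close> by simp
    next
      case 2
      then obtain \<sigma> where \<sigma>: "\<sigma> \<in> all_bars N" "\<sigma> \<in> all_bars N'" "s = e \<sigma>" "t = e' \<sigma>"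
        by (auto simp: M_def)
      show ?thesis
        using shift [where L = N and L' = N', OF inter(1)] shift [where L = N' and L' = N, OF inter(2)] \<open>\<delta> \<ge> 0\<close>
        by (simp add: 2 \<sigma> e(2) e'(2) bd [OF mono(1)] bd [OF mono(2)] endpoint_dist_le)
    next
      case 3
      then obtain \<sigma> where \<sigma>: "\<sigma> \<in> all_bars N" "s = e \<sigma>"
        using e(1) by (auto simp: bij_betw_def)
      hence "\<sigma> \<notin> all_bars N'"
        using 3 by (auto simp: dom)
      thus ?thesis
        using unmatched [where L = N and L' = N', OF \<sigma>(1) _ inter empty(1)] by (simp add: 3 \<sigma> e(2) bd [OF mono(1)])
    next
      case 4
      then obtain \<sigma> where \<sigma>: "\<sigma> \<in> all_bars N'" "s = e' \<sigma>"
        using e'(1) by (auto simp: bij_betw_def)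
      hence "\<sigma> \<notin> all_bars N"
        using 4 by (auto simp: dom)
      thus ?thesis
        using unmatched [where L = N' and L' = N, OF \<sigma>(1) _ inter(2,1) empty(2)] by (simp add: 4 \<sigma> e'(2) bd [OF mono(2)])
    qed
  qed
  finally show ?thesis .
qed

section \<open>Interleaving of neighbourhood filtrations\<close>

lemma nbhd_filtration_iff:
  "x \<in> nbhd_filtration X z f a \<longleftrightarrow> x \<in> X \<and> (\<forall>t. a \<le> f t \<longrightarrow> norm (x - z) \<le> t)"
  \<comment> \<open>A bound by an infimum is a bound by every element, which removes the generalized
    inverse and the extended reals.\<close>
  by (auto simp: nbhd_filtration_def nbhd_def gen_inverse_def le_Inf_iff)

lemma mono_nbhd_filtration: "mono (nbhd_filtration X z f)"
proof (rule monoI, rule subsetI)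
  fix a b x assume "a \<le> b" "x \<in> nbhd_filtration X z f a"
  thus "x \<in> nbhd_filtration X z f b"
    unfolding nbhd_filtration_iff using order_trans by blast
qed

lemma nbhd_filtration_nonpos:
  assumes "\<And>t. f t \<ge> 0" "a \<le> 0"
  shows "nbhd_filtration X z f a = {}"
proof -
  have "x \<notin> nbhd_filtration X z f a" for x
  proof
    assume "x \<in> nbhd_filtration X z f a"
    moreover have "a \<le> f (- 1)"
      using assms order_trans by blast
    ultimately have "norm (x - z) \<le> - 1"
      by (simp add: nbhd_filtration_iff)
    thus False
      using norm_ge_zero [of "x - z"] by linarith
  qed
  thus ?thesis by blast
qed

text \<open>The triangle inequality moves the centre at the cost of \<open>norm (z - z')\<close> in
  the radius. Levels \<open>a \<le> 0\<close> are exempt because the filtration is empty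
  there.\<close>

lemma nbhd_filtration_subset:
  fixes z z' :: "'a::real_normed_vector"
  assumes h: "\<And>t. h t \<ge> 0"
    and shift: "\<And>t. g t \<ge> a + \<delta> \<Longrightarrow> (t \<ge> norm (z - z') \<and> h (t - norm (z - z')) \<ge> a) \<or> a \<le> 0"
  shows "nbhd_filtration X z h a \<subseteq> nbhd_filtration X z' g (a + \<delta>)"
proof
  fix x assume x: "x \<in> nbhd_filtration X z h a"
  hence "a > 0"
    using nbhd_filtration_nonpos [of h a X z] h by force
  have "norm (x - z') \<le> t" if "g t \<ge> a + \<delta>" for t
  proof -
    have "norm (x - z) \<le> t - norm (z - z')"
      using shift [OF that] x \<open>a > 0\<close> by (auto simp: nbhd_filtration_iff)
    thus ?thesis
      using norm_triangle_ineq [of "x - z" "z - z'"] by simp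
  qed
  thus "x \<in> nbhd_filtration X z' g (a + \<delta>)"
    using x by (simp add: nbhd_filtration_iff)
qed

theorem theorem1p3:
  fixes X :: "'a::euclidean_space set" and z z' :: 'a
    and f g :: "real \<Rightarrow> real"
  assumes "finite X"
    and "mono f" and "\<And>x. f x \<ge> 0"
    and "mono g" and "\<And>x. g x \<ge> 0"
    and "\<And>x y. x \<ge> 0 \<Longrightarrow> y \<ge> 0 \<Longrightarrow> f (x + y) \<le> f x + f y"
  shows "bottleneck_dist
           (weighted_barcode TYPE('k::field) (nbhd_filtration X z f))
           (weighted_barcode TYPE('k) (nbhd_filtration X z' g))
         \<le> sup_dist f g + ereal (f (norm (z - z')))"
proof (cases "sup_dist f g = \<infinity>")
  case True
  thus ?thesis by simp
next
  case False
  have le: "ereal \<bar>f x - g x\<bar> \<le> sup_dist f g" for x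
    unfolding sup_dist_def by (rule SUP_upper) simp
  obtain \<epsilon> where \<epsilon>: "sup_dist f g = ereal \<epsilon>"
    using False le [of 0] by (cases "sup_dist f g") auto
  have close: "\<bar>f x - g x\<bar> \<le> \<epsilon>" for x
    using le [of x] by (simp add: \<epsilon>)
  define D where "D = norm (z - z')"
  \<comment> \<open>Subadditivity covers only nonnegative arguments. For \<open>t < D\<close>
    monotonicity gives \<open>f t \<le> f D\<close>, which will confine the level to
    \<open>a \<le> 0\<close>.\<close>
  have f_le: "t \<ge> D \<and> f t \<le> f (t - D) + f D \<or> f t \<le> f D" for t
    using assms(6) [of "t - D" D] monoD [OF assms(2), of t D]
    by (cases "t \<ge> D") (auto simp: D_def)
  have "bottleneck_dist (weighted_barcode TYPE('k) (nbhd_filtration X z f))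
      (weighted_barcode TYPE('k) (nbhd_filtration X z' g)) \<le> ereal (\<epsilon> + f D)"
  proof (rule bottleneck_dist_interleaved_le)
    show "finite X" by fact
    show "nbhd_filtration X z f a \<subseteq> X" "nbhd_filtration X z' g a \<subseteq> X" for a
      by (auto simp: nbhd_filtration_iff)
    show "0 \<le> \<epsilon> + f D"
      using close [of 0] assms(3) [of D] by linarith
    show "nbhd_filtration X z f a \<subseteq> nbhd_filtration X z' g (a + (\<epsilon> + f D))" for a
    proof (rule nbhd_filtration_subset [OF assms(3)], fold D_def)
      fix t assume "a + (\<epsilon> + f D) \<le> g t"
      hence "a + f D \<le> f t"
        using close [of t] by linarith
      thus "t \<ge> D \<and> f (t - D) \<ge> a \<or> a \<le> 0"
        using f_le [of t] by linarith
    qed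
    show "nbhd_filtration X z' g a \<subseteq> nbhd_filtration X z f (a + (\<epsilon> + f D))" for a
    proof (rule nbhd_filtration_subset [OF assms(5)],
        unfold norm_minus_commute [of z' z], fold D_def)
      fix t assume "a + (\<epsilon> + f D) \<le> f t"
      \<comment> \<open>Subadditivity is again applied to \<open>f\<close>, and only then is
        \<open>f\<close> exchanged for \<open>g\<close>, at \<open>t - D\<close>. For
        \<open>t < D\<close> it follows that \<open>a \<le> - \<epsilon>\<close>; the estimate at 0
        supplies \<open>\<epsilon> \<ge> 0\<close>.\<close>
      thus "t \<ge> D \<and> g (t - D) \<ge> a \<or> a \<le> 0"
        using f_le [of t] close [of "t - D"] close [of 0] by linarith
    qed
  qed (simp_all add: mono_nbhd_filtration nbhd_filtration_nonpos assms(3,5))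
  thus ?thesis
    by (simp add: \<epsilon> D_def)
qed

end
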